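(* Let $u_0\in L^\infty(\Omega)$ satisfy $u_0(x)\le 0$ for a.e. $x\in\Omega$ and $u_0\not\equiv 0$, and let $u$ be the corresponding global solution of Problem $(P)$. Then the unique element $\varphi$ of $\omega(u_0)$ is given by $$\varphi=\lambda_\infty\,\chi_{\Omega_-(0)},$$ where $\Omega_-(0):=\{x\in\Omega: u_0(x)<0\}$ and $\lambda_\infty$ $\bigl(=\lim_{t\to\infty}\lambda(t)\bigr)$ is defined by $$\lambda_\infty|\Omega_-(0)|=\int_\Omega u_0(x)\,dx.$$
   Context: $\Omega$ is an open bounded subset of $\mathbb{R}^N$, $N\ge 1$; $|A|$ is the Lebesgue measure of $A$ and $\chi_A$ its characteristic function. Set $f(z):=z^2(1-z)$ and $g(z):=z(1-z)$ for $z\in\mathbb{R}$. Problem $(P)$ is the nonlocal differential equation $u_t=u^2(1-u)-\lambda(t)\,u(1-u)$ for $x\in\Omega$, $t\ge 0$, with $u(x,0)=u_0(x)$, where $$\lambda(t):=\frac{\int_\Omega u^2(1-u)(x,t)\,dx}{\int_\Omega u(1-u)(x,t)\,dx}.$$ A (global) solution is a function $u\in C^1([0,\infty);L^\infty(\Omega))$ with $u(0)=u_0$, $\int_\Omega g(u(x,t))\,dx\ne 0$ for all $t\ge 0$, and $u_t(x,t)=f(u(x,t))-\lambda(t)g(u(x,t))$ for a.e. $x\in\Omega$ and all $t\ge0$. Known fact: if $u_0\in L^\infty(\Omega)$, $u_0\le0$ a.e. and $u_0\not\equiv0$ (not a.e. equal to $0$), then $(P)$ has a global solution $u$, and $\operatorname{ess\,inf}_\Omega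 u_0\le u(x,t)\le 0$ for a.e. $x\in\Omega$ and all $t\ge0$; $u$ and $\lambda$ refer to this solution. Moreover in this case the limit $\lambda_\infty=\lim_{t\to\infty}\lambda(t)$ exists and $\lambda_\infty<0$. The $\omega$-limit set $\omega(u_0)$ is the set of all $\varphi\in L^1(\Omega)$ for which there is a sequence $(t_n)_{n\ge1}$ with $t_n\to\infty$ and $\|u(t_n)-\varphi\|_{L^1(\Omega)}\to0$ as $n\to\infty$. *)

theory Defs
  imports "HOL-Analysis.Analysis" "HOL-Probability.Essential_Supremum"
begin

text \<open>
  Elements of L-infinity and L1 over a set \<open>\<Omega>\<close> are represented by functions, identified when they
  agree almost everywhere; a time-dependent function is a map \<open>u\<close> with \<open>u t x\<close> its value at time \<open>t\<close>
  and point \<open>x\<close>. Only times \<open>t \<ge> 0\<close> are ever inspected.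
\<close>

definition Linf_norm :: "'a::euclidean_space set \<Rightarrow> ('a \<Rightarrow> real) \<Rightarrow> ereal" where
  "Linf_norm \<Omega> h = esssup (lebesgue_on \<Omega>) (\<lambda>x. ereal \<bar>h x\<bar>)"

definition Linf :: "'a::euclidean_space set \<Rightarrow> ('a \<Rightarrow> real) set" where
  "Linf \<Omega> = {h \<in> borel_measurable (lebesgue_on \<Omega>). Linf_norm \<Omega> h < \<infinity>}"

text \<open>
  \<open>C1_Linf \<Omega> u v\<close>: \<open>u\<close> lies in \<open>C\<^sup>1([0,\<infinity>); L\<^sup>\<infinity>(\<Omega>))\<close> and has derivative \<open>v\<close> there. The difference
  quotients converge in the L-infinity norm (one-sided at \<open>t = 0\<close>), and \<open>v\<close> is continuous in that
  norm.
\<close>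

definition C1_Linf ::
  "'a::euclidean_space set \<Rightarrow> (real \<Rightarrow> 'a \<Rightarrow> real) \<Rightarrow> (real \<Rightarrow> 'a \<Rightarrow> real) \<Rightarrow> bool" where
  "C1_Linf \<Omega> u v \<longleftrightarrow>
     (\<forall>t\<ge>0. u t \<in> Linf \<Omega> \<and> v t \<in> Linf \<Omega>) \<and>
     (\<forall>t\<ge>0. ((\<lambda>s. Linf_norm \<Omega> (\<lambda>x. (u s x - u t x) / (s - t) - v t x)) \<longlongrightarrow> 0) (at t within {0..})) \<and>
     (\<forall>t\<ge>0. ((\<lambda>s. Linf_norm \<Omega> (\<lambda>x. v s x - v t x)) \<longlongrightarrow> 0) (at t within {0..}))"

definition f_react :: "real \<Rightarrow> real" where
  "f_react z = z\<^sup>2 * (1 - z)"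

definition g_react :: "real \<Rightarrow> real" where
  "g_react z = z * (1 - z)"

definition lam :: "'a::euclidean_space set \<Rightarrow> (real \<Rightarrow> 'a \<Rightarrow> real) \<Rightarrow> real \<Rightarrow> real" where
  "lam \<Omega> u t = (LINT x|lebesgue_on \<Omega>. f_react (u t x)) / (LINT x|lebesgue_on \<Omega>. g_react (u t x))"

text \<open>
  The differential equation is an identity between elements of L-infinity at each time, so the
  exceptional null set may depend on \<open>t\<close>.
\<close>

definition global_solution ::
  "'a::euclidean_space set \<Rightarrow> ('a \<Rightarrow> real) \<Rightarrow> (real \<Rightarrow> 'a \<Rightarrow> real) \<Rightarrow> bool" where
  "global_solution \<Omega> u\<^sub>0 u \<longleftrightarrow>
     (\<exists>u_t. C1_Linf \<Omega> u u_t \<and>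
        (AE x in lebesgue_on \<Omega>. u 0 x = u\<^sub>0 x) \<and>
        (\<forall>t\<ge>0. (LINT x|lebesgue_on \<Omega>. g_react (u t x)) \<noteq> 0) \<and>
        (\<forall>t\<ge>0. AE x in lebesgue_on \<Omega>.
           u_t t x = f_react (u t x) - lam \<Omega> u t * g_react (u t x)))"

definition omega_limit_set ::
  "'a::euclidean_space set \<Rightarrow> (real \<Rightarrow> 'a \<Rightarrow> real) \<Rightarrow> ('a \<Rightarrow> real) set" where
  "omega_limit_set \<Omega> u =
     {\<phi>. integrable (lebesgue_on \<Omega>) \<phi> \<and>
        (\<exists>t :: nat \<Rightarrow> real. (\<forall>n. t n \<ge> 0) \<and> filterlim t at_top sequentially \<and>
           (\<lambda>n. LINT x|lebesgue_on \<Omega>. \<bar>u (t n) x - \<phi> x\<bar>) \<longlonglongrightarrow> 0)}"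

definition Omega_minus :: "'a set \<Rightarrow> ('a \<Rightarrow> real) \<Rightarrow> 'a set" where
  "Omega_minus \<Omega> u\<^sub>0 = {x \<in> \<Omega>. u\<^sub>0 x < 0}"

end

theory Submission
  imports Defs
begin

text \<open>
  Along the flow the integral of \<open>u\<close> is conserved, and almost every sample path solves the scalar
  equation \<open>w' = g(w) (w - \<lambda>(t))\<close>. Paths starting at \<open>0\<close> stay there. For two negative paths the
  function \<open>q(z) = ln (-z) - ln (1 - z)\<close> satisfies \<open>(q(w\<^sub>1) - q(w\<^sub>2))' = w\<^sub>1 - w\<^sub>2\<close>, and \<open>q\<close> is
  decreasing, so \<open>(q(w\<^sub>1) - q(w\<^sub>2))\<^sup>2\<close> is a Lyapunov function whose dissipation controls
  \<open>(w\<^sub>1 - w\<^sub>2)\<^sup>2\<close>; hence \<open>w\<^sub>1 - w\<^sub>2 \<rightarrow> 0\<close>. All paths starting in \<open>\<Omega>\<^sub>-(0)\<close> thus merge into a single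
  one, and conservation of the integral together with dominated convergence identifies its limit.
\<close>

section \<open>Scalar kinetics\<close>

text \<open>The obstacle is the exceptional set. The equation holds at each time off a null set that
  may vary with the time, and uncountably many null sets cannot be united; so for a fixed point x
  the values \<open>u t x\<close> need not even be continuous in t. Paths are therefore rebuilt from
  rational times: on each [0,T] the increments are controlled with a step size independent of time,
  countably many null sets cover all rational pairs, and the limit along rational times is a genuine
  trajectory, equal to \<open>u t\<close> a.e. at each fixed t. The coordinate exists because
  \<open>f_react z = z * g_react z\<close>, which puts the factor g into the whole right-hand side.
  Its slope 1/g blows up at 0 but stays away from 0 on [-M,0), so the dissipation controls the
  distance even for paths that come close to 0. The nonlocality enters through one fact:
  \<lambda>(t) is the value for which the right-hand side has integral 0. Mass conservation and the
  lower bound for u both rest on it. The limit of \<lambda>(t) is read off from the limit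
  profile.\<close>

lemma mvt_half_line:
  fixes E E' :: "real \<Rightarrow> real"
  assumes E: "\<And>t. t \<ge> 0 \<Longrightarrow> (E has_real_derivative E' t) (at t within {0..})"
    and "0 \<le> s" "s < t"
  obtains \<xi> where "s < \<xi>" "\<xi> < t" "E t - E s = (t - s) * E' \<xi>"
proof -
  have d: "(E has_real_derivative E' x) (at x)" if "s < x" for x
    using E[of x] at_within_interior[of x "{0..}"] that \<open>0 \<le> s\<close> by simp
  have "continuous_on {0..} E"
    by (rule DERIV_continuous_on[OF E]) auto
  then have "continuous_on {s..t} E"
    by (rule continuous_on_subset) (use \<open>0 \<le> s\<close> in auto)
  then obtain l z where z: "s < z" "z < t" "(E has_real_derivative l) (at z)"
      "E t - E s = (t - s) * l"
    using MVT[OF \<open>s < t\<close>, of E] d by (auto simp: real_differentiable_def)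
  have "l = E' z" by (rule DERIV_unique[OF z(3) d[OF z(1)]])
  with that[OF z(1,2)] z(4) show thesis by simp
qed

lemma antimono_half_line:
  fixes E E' :: "real \<Rightarrow> real"
  assumes E: "\<And>t. t \<ge> 0 \<Longrightarrow> (E has_real_derivative E' t) (at t within {0..})"
    and neg: "\<And>t. t \<ge> 0 \<Longrightarrow> E' t \<le> 0"
    and "0 \<le> s" "s \<le> t"
  shows "E t \<le> E s"
proof (cases "s = t")
  case False
  with \<open>s \<le> t\<close> have "s < t" by simp
  from mvt_half_line[OF E \<open>0 \<le> s\<close> this] obtain \<xi>
    where x: "s < \<xi>" "\<xi> < t" "E t - E s = (t - s) * E' \<xi>" by blast
  have "(t - s) * E' \<xi> \<le> 0"
    using x \<open>0 \<le> s\<close> neg[of \<xi>] by (intro mult_nonneg_nonpos) auto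
  with x show ?thesis by simp
qed simp

lemma lipschitz_half_line:
  fixes E E' :: "real \<Rightarrow> real"
  assumes E: "\<And>t. t \<ge> 0 \<Longrightarrow> (E has_real_derivative E' t) (at t within {0..})"
    and bd: "\<And>t. t \<ge> 0 \<Longrightarrow> \<bar>E' t\<bar> \<le> K"
    and "0 \<le> s" "s < t"
  shows "\<bar>E t - E s\<bar> \<le> K * (t - s)"
proof -
  from mvt_half_line[OF E \<open>0 \<le> s\<close> \<open>s < t\<close>] obtain \<xi>
    where x: "s < \<xi>" "\<xi> < t" "E t - E s = (t - s) * E' \<xi>" by blast
  have "(t - s) * \<bar>E' \<xi>\<bar> \<le> (t - s) * K"
    using x \<open>0 \<le> s\<close> \<open>s < t\<close> bd[of \<xi>] by (intro mult_left_mono) auto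
  with x show ?thesis by (simp add: abs_mult mult.commute)
qed

lemma antimono_bounded_below_convergent_at_top:
  fixes E :: "real \<Rightarrow> real"
  assumes dec: "\<And>s t. 0 \<le> s \<Longrightarrow> s \<le> t \<Longrightarrow> E t \<le> E s"
    and lb: "\<And>t. 0 \<le> t \<Longrightarrow> B \<le> E t"
  obtains L where "(E \<longlongrightarrow> L) at_top"
proof -
  have bdd: "bdd_below (E ` {0..})" using lb by (auto intro!: bdd_belowI)
  have "(E \<longlongrightarrow> Inf (E ` {0..})) at_top"
  proof (rule order_tendstoI)
    fix a assume "a < Inf (E ` {0..})"
    then have *: "a < E t" if "t \<ge> 0" for t
      using cInf_lower[OF _ bdd, of "E t"] that by force
    show "\<forall>\<^sub>F t in at_top. a < E t"
      by (rule eventually_mono[OF eventually_ge_at_top[of 0]]) (rule *)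
  next
    fix a assume "Inf (E ` {0..}) < a"
    then obtain s where "s \<ge> 0" "E s < a"
      using cInf_lessD[of "E ` {0..}" a] by auto
    then show "\<forall>\<^sub>F t in at_top. E t < a"
      using dec by (intro eventually_mono[OF eventually_ge_at_top[of s]]) (auto intro: le_less_trans)
  qed
  with that show thesis .
qed

text \<open>A form of Barbalat's lemma: along a step of length \<open>\<delta>\<close> the energy drops by at least
  \<open>\<delta> (p t - L \<delta>)\<close>.\<close>

lemma dissipation_tendsto_0:
  fixes E E' p :: "real \<Rightarrow> real"
  assumes E: "\<And>t. t \<ge> 0 \<Longrightarrow> (E has_real_derivative E' t) (at t within {0..})"
    and E_nonneg: "\<And>t. t \<ge> 0 \<Longrightarrow> 0 \<le> E t"
    and E'_le: "\<And>t. t \<ge> 0 \<Longrightarrow> E' t \<le> - p t"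
    and p_nonneg: "\<And>t. t \<ge> 0 \<Longrightarrow> 0 \<le> p t"
    and p_lip: "\<And>s t. 0 \<le> s \<Longrightarrow> s < t \<Longrightarrow> \<bar>p t - p s\<bar> \<le> L * (t - s)"
    and "L > 0"
  shows "(p \<longlongrightarrow> 0) at_top"
proof -
  have "E t \<le> E s" if "0 \<le> s" "s \<le> t" for s t
    using antimono_half_line[OF E _ that] E'_le p_nonneg by force
  then obtain l where l: "(E \<longlongrightarrow> l) at_top"
    using antimono_bounded_below_convergent_at_top[of E 0] E_nonneg by blast
  show ?thesis
  proof (rule order_tendstoI)
    fix e :: real assume "0 < e"
    \<comment> \<open>Within a step of this length p loses at most L * \<delta> = e / 2, so
      \<open>p t \<ge> e\<close> would force the energy to drop by at least \<delta> * e / 2. Drops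
      over a fixed step tend to 0, which excludes this for large t.\<close>
    define \<delta> where "\<delta> = e / (2 * L)"
    have \<delta>: "\<delta> > 0" "L * \<delta> = e / 2"
      using \<open>0 < e\<close> \<open>L > 0\<close> by (auto simp: \<delta>_def field_simps)
    have "filterlim (\<lambda>t. t + \<delta>) at_top at_top"
      by (rule filterlim_at_top_mono[OF filterlim_ident]) (use \<delta> in auto)
    then have "((\<lambda>t. E (t + \<delta>)) \<longlongrightarrow> l) at_top"
      by (rule filterlim_compose[OF l])
    then have "((\<lambda>t. E t - E (t + \<delta>)) \<longlongrightarrow> 0) at_top"
      using tendsto_diff[OF l] by fastforce
    then have "\<forall>\<^sub>F t in at_top. E t - E (t + \<delta>) < \<delta> * (e / 2)"
      using \<delta> \<open>0 < e\<close> by (intro order_tendstoD(2)) auto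
    then show "\<forall>\<^sub>F t in at_top. p t < e"
      using eventually_ge_at_top[of 0]
    proof eventually_elim
      case (elim t)
      from mvt_half_line[OF E \<open>0 \<le> t\<close>, of "t + \<delta>"] \<delta> obtain \<xi>
        where x: "t < \<xi>" "\<xi> < t + \<delta>" "E (t + \<delta>) - E t = \<delta> * E' \<xi>" by auto
      have "L * (\<xi> - t) < L * \<delta>" using x \<open>L > 0\<close> by simp
      then have "p t - e / 2 < p \<xi>"
        using p_lip[of t \<xi>] x elim \<delta> by linarith
      also have "\<dots> \<le> - E' \<xi>" using E'_le[of \<xi>] x elim by simp
      finally have "\<delta> * (p t - e / 2) < \<delta> * (- E' \<xi>)" using \<delta>(1) by (rule mult_strict_left_mono)
      also have "\<dots> < \<delta> * (e / 2)" using x elim by simp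
      finally have "p t - e / 2 < e / 2" using \<delta>(1) by (simp only: mult_less_cancel_left_pos)
      then show "p t < e" by simp
    qed
  next
    fix a :: real assume "a < 0"
    then show "\<forall>\<^sub>F t in at_top. a < p t"
      using p_nonneg by (intro eventually_mono[OF eventually_ge_at_top[of 0]]) (auto intro: less_le_trans)
  qed
qed

section \<open>The scalar equation with a prescribed continuous coefficient\<close>

locale kinetics =
  fixes l :: "real \<Rightarrow> real"
  assumes l_cont: "continuous_on {0..} l"
begin

definition trajectory :: "(real \<Rightarrow> real) \<Rightarrow> bool" where
  "trajectory w \<longleftrightarrow>
     (\<forall>t\<ge>0. (w has_real_derivative g_react (w t) * (w t - l t)) (at t within {0..}))"

text \<open>Since g(w) contains the factor w, the equation along a given path is linear: w' = a w
  with the continuous coefficient a = (1 - w)(w - l). If C' = a, then w exp(-C) is constant. The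
  positive factor \<open>k\<close> serves both uses at once: zero stays zero, and a negative start
  stays negative.\<close>

lemma trajectory_sign:
  assumes w: "trajectory w" and "0 \<le> t"
  obtains k where "k > 0" "w t = k * w 0"
proof (cases "t = 0")
  case True
  with that[of 1] show thesis by simp
next
  case False
  with \<open>0 \<le> t\<close> have "0 < t" by simp
  have w': "(w has_real_derivative g_react (w s) * (w s - l s)) (at s within {0..t})"
    if "s \<in> {0..t}" for s
    using w that DERIV_subset[of w _ s "{0..}" "{0..t}"] by (auto simp: trajectory_def)
  have "continuous_on {0..t} w" by (rule DERIV_continuous_on[OF w'])
  moreover have "continuous_on {0..t} l"
    by (rule continuous_on_subset[OF l_cont]) auto
  ultimately have "continuous_on {0..t} (\<lambda>s. (1 - w s) * (w s - l s))"
    by (intro continuous_intros)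
  then obtain C where C: "\<And>s. s \<in> {0..t} \<Longrightarrow>
      (C has_vector_derivative (1 - w s) * (w s - l s)) (at s within {0..t})"
    using antiderivative_continuous by blast
  have "((\<lambda>s. w s * exp (- C s)) has_field_derivative 0) (at s within {0..t})"
    if "s \<in> {0..t}" for s
    using C[OF that]
    by (auto intro!: derivative_eq_intros w'[OF that]
        simp: has_real_derivative_iff_has_vector_derivative[symmetric] g_react_def algebra_simps)
  then obtain c where "\<forall>s\<in>{0..t}. w s * exp (- C s) = c"
    using has_field_derivative_zero_constant[of "{0..t}" "\<lambda>s. w s * exp (- C s)"] by auto
  with \<open>0 < t\<close> have "w t * exp (- C t) = w 0 * exp (- C 0)" by auto
  then have "w t = exp (C t - C 0) * w 0"
    by (simp add: exp_minus exp_diff field_simps)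
  with that[of "exp (C t - C 0)"] show thesis by simp
qed

end

text \<open>The coordinate is chosen so that \<open>q' g = 1\<close>: along a trajectory \<open>q \<circ> w\<close> has
  derivative \<open>w - l\<close>, and \<open>l\<close> cancels between two trajectories.\<close>

definition q_lin :: "real \<Rightarrow> real" where
  "q_lin z = ln (- z) - ln (1 - z)"

lemma q_lin_deriv:
  assumes "z < 0"
  shows "(q_lin has_real_derivative 1 / g_react z) (at z)"
  unfolding q_lin_def using assms
  by (auto intro!: derivative_eq_intros simp: g_react_def divide_simps)

text \<open>Mean value theorem with slope 1/g: on [-M,0) one has 0 < -z (1 - z) \<le> M (1 + M), so
  the slope is at most -1/(M (1 + M)). The constant does not degenerate as the arguments approach
  0.\<close>

lemma q_lin_diff:
  assumes "- M \<le> a" "a < 0" "- M \<le> b" "b < 0"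
  shows "(q_lin a - q_lin b) * (a - b) \<le> - ((a - b)\<^sup>2 / (M * (1 + M)))"
proof -
  have *: "(q_lin b - q_lin a) * (b - a) \<le> - ((b - a)\<^sup>2 / (M * (1 + M)))"
    if "- M \<le> a" "b < 0" "a < b" for a b
  proof -
    from that have "\<exists>z>a. z < b \<and> q_lin b - q_lin a = (b - a) * (1 / g_react z)"
      by (intro MVT2 q_lin_deriv) auto
    then obtain z where z: "a < z" "z < b" "q_lin b - q_lin a = (b - a) * (1 / g_react z)"
      by blast
    with that have z': "0 < - z" "- z \<le> M" by auto
    then have "- z * (1 - z) \<le> M * (1 + M)" by (intro mult_mono) auto
    moreover have "0 < - z * (1 - z)" using z' by (intro mult_pos_pos) auto
    ultimately have "1 / (M * (1 + M)) \<le> 1 / (- z * (1 - z))"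
      using z' by (intro divide_left_mono mult_pos_pos) auto
    also have "\<dots> = - (1 / g_react z)" by (simp add: g_react_def)
    finally have "1 / g_react z \<le> - (1 / (M * (1 + M)))" by linarith
    then have "(b - a)\<^sup>2 * (1 / g_react z) \<le> (b - a)\<^sup>2 * (- (1 / (M * (1 + M))))"
      by (intro mult_left_mono) auto
    with z show ?thesis by (simp add: power2_eq_square mult_ac)
  qed
  consider "a < b" | "a = b" | "b < a" by linarith
  then show ?thesis
  proof cases
    case 1
    have "(q_lin a - q_lin b) * (a - b) = (q_lin b - q_lin a) * (b - a)"
      by (simp add: algebra_simps)
    then show ?thesis using *[of a b] assms 1 by (simp add: power2_commute)
  qed (use *[of b a] assms in auto)
qed

context kinetics
begin

text \<open>The energy is the squared difference of the coordinates and the dissipation a multiple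
  of the squared distance of the paths. The dissipation is Lipschitz in time because the paths have
  bounded range and bounded speed, so \<open>dissipation_tendsto_0\<close> applies.\<close>

lemma trajectories_merge:
  assumes w: "trajectory w" "trajectory w'"
    and bd: "\<And>t. t \<ge> 0 \<Longrightarrow> - M \<le> w t \<and> w t < 0" "\<And>t. t \<ge> 0 \<Longrightarrow> - M \<le> w' t \<and> w' t < 0"
    and l_bd: "\<And>t. t \<ge> 0 \<Longrightarrow> \<bar>l t\<bar> \<le> M"
  shows "((\<lambda>t. w t - w' t) \<longlongrightarrow> 0) at_top"
proof -
  have "M > 0" using bd(1)[of 0] by simp
  \<comment> \<open>Speed bound, factor by factor: |w| \<le> M, |1 - w| \<le> 1 + M and |w - l|
    \<le> 2 M.\<close>
  define K where "K = M * (1 + M) * (2 * M)"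
  have lip: "\<bar>z t - z s\<bar> \<le> K * (t - s)"
    if z: "trajectory z" and zbd: "\<And>t. t \<ge> 0 \<Longrightarrow> - M \<le> z t \<and> z t < 0" and st: "0 \<le> s" "s < t" for z s t
  proof (rule lipschitz_half_line[OF _ _ st])
    fix r :: real assume r: "r \<ge> 0"
    show "(z has_real_derivative g_react (z r) * (z r - l r)) (at r within {0..})"
      using z r by (simp add: trajectory_def)
    show "\<bar>g_react (z r) * (z r - l r)\<bar> \<le> K"
      unfolding K_def g_react_def abs_mult using zbd[OF r] l_bd[OF r] \<open>M > 0\<close>
      by (intro mult_mono) auto
  qed
  \<comment> \<open>Twice the constant of \<open>q_lin_diff\<close>, since the derivative of D^2 is
    2 D d.\<close>
  define c where "c = 2 / (M * (1 + M))"
  define d where "d = (\<lambda>t. w t - w' t)"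
  define D where "D = (\<lambda>t. q_lin (w t) - q_lin (w' t))"
  have "c > 0" "K > 0" using \<open>M > 0\<close> by (auto simp: c_def K_def)
  have q': "((\<lambda>t. q_lin (z t)) has_real_derivative z t - l t) (at t within {0..})"
    if "trajectory z" "z t < 0" "t \<ge> 0" for z t
  proof -
    have "g_react (z t) \<noteq> 0" using that by (simp add: g_react_def)
    then show ?thesis
      using DERIV_chain2[where g = z, OF q_lin_deriv[OF \<open>z t < 0\<close>],
          of "g_react (z t) * (z t - l t)" "{0..}"] that
      by (simp add: trajectory_def)
  qed
  have D': "(D has_real_derivative d t) (at t within {0..})" if "t \<ge> 0" for t
    unfolding D_def d_def using bd(1)[OF that] bd(2)[OF that]
    by (auto intro!: derivative_eq_intros q' w that)
  have "((\<lambda>t. c * (d t)\<^sup>2) \<longlongrightarrow> 0) at_top"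
  proof (rule dissipation_tendsto_0)
    fix t :: real assume t: "t \<ge> 0"
    show "((\<lambda>t. (D t)\<^sup>2) has_real_derivative 2 * (D t * d t)) (at t within {0..})"
      by (auto intro!: derivative_eq_intros D' t)
    show "2 * (D t * d t) \<le> - (c * (d t)\<^sup>2)"
      using q_lin_diff[of M "w t" "w' t"] bd(1)[OF t] bd(2)[OF t]
      by (auto simp: D_def d_def c_def)
  next
    fix s t :: real assume st: "0 \<le> s" "s < t"
    have "\<bar>d t - d s\<bar> \<le> 2 * K * (t - s)"
      using lip[OF w(1) bd(1) st] lip[OF w(2) bd(2) st] unfolding d_def by simp
    moreover have "\<bar>d t + d s\<bar> \<le> 2 * M"
      using bd(1)[of s] bd(2)[of s] bd(1)[of t] bd(2)[of t] st unfolding d_def by (simp add: abs_le_iff)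
    ultimately have "\<bar>d t - d s\<bar> * \<bar>d t + d s\<bar> \<le> (2 * K * (t - s)) * (2 * M)"
      using st \<open>K > 0\<close> by (intro mult_mono) auto
    then have "c * \<bar>(d t)\<^sup>2 - (d s)\<^sup>2\<bar> \<le> c * ((2 * K * (t - s)) * (2 * M))"
      using \<open>c > 0\<close> by (intro mult_left_mono) (auto simp: power2_eq_square square_diff_square_factored abs_mult mult_ac)
    then show "\<bar>c * (d t)\<^sup>2 - c * (d s)\<^sup>2\<bar> \<le> (c * 2 * K * (2 * M)) * (t - s)"
      using \<open>c > 0\<close> by (simp add: right_diff_distrib[symmetric] abs_mult mult_ac)
  qed (use \<open>c > 0\<close> \<open>K > 0\<close> \<open>M > 0\<close> in auto)
  from tendsto_mult_right[OF this, of "1 / c"] have "((\<lambda>t. (d t)\<^sup>2) \<longlongrightarrow> 0) at_top"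
    using \<open>c > 0\<close> by simp
  then have "((\<lambda>t. sqrt ((d t)\<^sup>2)) \<longlongrightarrow> sqrt 0) at_top"
    by (rule tendsto_real_sqrt)
  then show ?thesis
    unfolding d_def by (simp add: tendsto_rabs_zero_iff)
qed

end

section \<open>Differentiable curves in \<open>L\<^sup>\<infinity>\<close>\<close>

lemma AE_le_of_Linf_norm_less:
  assumes "Linf_norm \<Omega> h < ereal e"
  shows "AE x in lebesgue_on \<Omega>. \<bar>h x\<bar> \<le> e"
  using esssup_AE[of "\<lambda>x. ereal \<bar>h x\<bar>" "lebesgue_on \<Omega>"]
proof eventually_elim
  case (elim x)
  also have "esssup (lebesgue_on \<Omega>) (\<lambda>x. ereal \<bar>h x\<bar>) < ereal e"
    using assms by (simp add: Linf_norm_def)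
  finally show ?case by simp
qed

lemma Linf_imp_AE_bounded:
  assumes "h \<in> Linf \<Omega>"
  shows "\<exists>B>0. AE x in lebesgue_on \<Omega>. \<bar>h x\<bar> \<le> B"
proof -
  from assms have "Linf_norm \<Omega> h < \<infinity>" by (simp add: Linf_def)
  then obtain n :: nat where "Linf_norm \<Omega> h < ereal (real n)"
    using less_PInf_Ex_of_nat[of "Linf_norm \<Omega> h"] by simp blast
  from AE_le_of_Linf_norm_less[OF this] have "AE x in lebesgue_on \<Omega>. \<bar>h x\<bar> \<le> real n + 1"
    by (rule AE_mp) auto
  then show ?thesis by (intro exI[of _ "real n + 1"]) simp
qed

locale C1_curve =
  fixes \<Omega> :: "'a::euclidean_space set" and u v :: "real \<Rightarrow> 'a \<Rightarrow> real"
  assumes lmeasurable: "\<Omega> \<in> lmeasurable"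
    and C1: "C1_Linf \<Omega> u v"
begin

sublocale finite_measure "lebesgue_on \<Omega>"
  by (rule finite_measure_lebesgue_on[OF lmeasurable])

lemma measurable_u [measurable]: "t \<ge> 0 \<Longrightarrow> u t \<in> borel_measurable (lebesgue_on \<Omega>)"
  and measurable_v [measurable]: "t \<ge> 0 \<Longrightarrow> v t \<in> borel_measurable (lebesgue_on \<Omega>)"
  using C1 by (auto simp: C1_Linf_def Linf_def)

text \<open>Turns convergence in the essential supremum norm into an inequality for each
  \<open>s\<close> separately, off a null set that may depend on \<open>s\<close>. All later
  estimates of curves take this form.\<close>

lemma Linf_small:
  fixes h :: "real \<Rightarrow> 'a \<Rightarrow> real"
  assumes "((\<lambda>s. Linf_norm \<Omega> (h s)) \<longlongrightarrow> 0) (at t within {0..})" "e > 0"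
  shows "\<exists>d>0. \<forall>s\<ge>0. s \<noteq> t \<longrightarrow> \<bar>s - t\<bar> < d \<longrightarrow> (AE x in lebesgue_on \<Omega>. \<bar>h s x\<bar> \<le> e)"
proof -
  have "\<forall>\<^sub>F s in at t within {0..}. Linf_norm \<Omega> (h s) < ereal e"
    using assms by (intro order_tendstoD(2)) auto
  then obtain d where d: "d > 0"
    "\<forall>s\<in>{0..}. s \<noteq> t \<and> dist s t < d \<longrightarrow> Linf_norm \<Omega> (h s) < ereal e"
    unfolding eventually_at by blast
  show ?thesis
  proof (intro exI[of _ d] conjI d(1) allI impI)
    fix s assume "s \<ge> 0" "s \<noteq> t" "\<bar>s - t\<bar> < d"
    with d(2) show "AE x in lebesgue_on \<Omega>. \<bar>h s x\<bar> \<le> e"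
      by (intro AE_le_of_Linf_norm_less) (auto simp: dist_real_def)
  qed
qed

text \<open>Clearing the denominator in the difference quotient makes the estimate trivially true at
  s = t, so this case needs no exclusion later.\<close>

lemma u_diff:
  assumes "t \<ge> 0" "e > 0"
  shows "\<exists>d>0. \<forall>s\<ge>0. \<bar>s - t\<bar> < d \<longrightarrow>
    (AE x in lebesgue_on \<Omega>. \<bar>u s x - u t x - (s - t) * v t x\<bar> \<le> e * \<bar>s - t\<bar>)"
proof -
  have "((\<lambda>s. Linf_norm \<Omega> (\<lambda>x. (u s x - u t x) / (s - t) - v t x)) \<longlongrightarrow> 0) (at t within {0..})"
    using C1 assms by (simp add: C1_Linf_def)
  from Linf_small[OF this \<open>e > 0\<close>] obtain d where d: "d > 0"
    "\<And>s. s \<ge> 0 \<Longrightarrow> s \<noteq> t \<Longrightarrow> \<bar>s - t\<bar> < d \<Longrightarrow>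
      AE x in lebesgue_on \<Omega>. \<bar>(u s x - u t x) / (s - t) - v t x\<bar> \<le> e" by blast
  have "AE x in lebesgue_on \<Omega>. \<bar>u s x - u t x - (s - t) * v t x\<bar> \<le> e * \<bar>s - t\<bar>"
    if "s \<ge> 0" "\<bar>s - t\<bar> < d" for s
  proof (cases "s = t")
    case False
    from d(2)[OF \<open>s \<ge> 0\<close> False that(2)] show ?thesis
    proof eventually_elim
      case (elim x)
      have "u s x - u t x - (s - t) * v t x = ((u s x - u t x) / (s - t) - v t x) * (s - t)"
        using False by (simp add: field_simps)
      then have "\<bar>u s x - u t x - (s - t) * v t x\<bar> = \<bar>(u s x - u t x) / (s - t) - v t x\<bar> * \<bar>s - t\<bar>"
        by (simp add: abs_mult)
      also have "\<dots> \<le> e * \<bar>s - t\<bar>" by (intro mult_right_mono elim) auto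
      finally show ?case .
    qed
  qed simp
  then show ?thesis by (intro exI[of _ d] conjI allI impI d(1))
qed

lemma v_cont:
  assumes "t \<ge> 0" "e > 0"
  shows "\<exists>d>0. \<forall>s\<ge>0. \<bar>s - t\<bar> < d \<longrightarrow> (AE x in lebesgue_on \<Omega>. \<bar>v s x - v t x\<bar> \<le> e)"
proof -
  have "((\<lambda>s. Linf_norm \<Omega> (\<lambda>x. v s x - v t x)) \<longlongrightarrow> 0) (at t within {0..})"
    using C1 assms by (simp add: C1_Linf_def)
  from Linf_small[OF this \<open>e > 0\<close>] obtain d where d: "d > 0"
    "\<And>s. s \<ge> 0 \<Longrightarrow> s \<noteq> t \<Longrightarrow> \<bar>s - t\<bar> < d \<Longrightarrow> AE x in lebesgue_on \<Omega>. \<bar>v s x - v t x\<bar> \<le> e"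
    by blast
  have "AE x in lebesgue_on \<Omega>. \<bar>v s x - v t x\<bar> \<le> e" if "s \<ge> 0" "\<bar>s - t\<bar> < d" for s
    using d(2)[OF that(1) _ that(2)] \<open>e > 0\<close> by (cases "s = t") auto
  then show ?thesis by (intro exI[of _ d] conjI allI impI d(1))
qed

lemma v_bounded:
  assumes "t \<ge> 0"
  shows "\<exists>B>0. AE x in lebesgue_on \<Omega>. \<bar>v t x\<bar> \<le> B"
proof -
  have "v t \<in> Linf \<Omega>" using C1 assms by (simp add: C1_Linf_def)
  then show ?thesis by (rule Linf_imp_AE_bounded)
qed

text \<open>Bisection: near each time the first-order expansion at that time bounds the curve, and
  bounds on adjacent intervals combine by their maximum. The constant is common to all times, while
  the null set still depends on the time.\<close>

lemma u_bounded:
  assumes "T \<ge> 0"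
  shows "\<exists>B>0. \<forall>t\<in>{0..T}. AE x in lebesgue_on \<Omega>. \<bar>u t x\<bar> \<le> B"
proof -
  \<comment> \<open>The short intervals in the local step of the bisection may stick out below 0,
    where nothing is known about \<open>u\<close>; the guard \<open>t \<ge> 0\<close> discards that
    portion.\<close>
  define P where "P a b \<longleftrightarrow> (\<exists>B>0. \<forall>t\<in>{a..b}. t \<ge> 0 \<longrightarrow>
    (AE x in lebesgue_on \<Omega>. \<bar>u t x\<bar> \<le> B))" for a b
  have "P 0 T"
    using \<open>T \<ge> 0\<close>
  proof (induction rule: Bolzano)
    case (trans a b c)
    from trans(1) obtain B where B: "B > 0"
      "\<forall>t\<in>{a..b}. t \<ge> 0 \<longrightarrow> (AE x in lebesgue_on \<Omega>. \<bar>u t x\<bar> \<le> B)" unfolding P_def by blast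
    from trans(2) obtain C where C:
      "\<forall>t\<in>{b..c}. t \<ge> 0 \<longrightarrow> (AE x in lebesgue_on \<Omega>. \<bar>u t x\<bar> \<le> C)" unfolding P_def by blast
    have *: "AE x in lebesgue_on \<Omega>. \<bar>u t x\<bar> \<le> max B C" if "t \<in> {a..c}" "t \<ge> 0" for t
    proof (cases "t \<le> b")
      case True
      with B that have "AE x in lebesgue_on \<Omega>. \<bar>u t x\<bar> \<le> B" by simp
      then show ?thesis by (rule AE_mp) auto
    next
      case False
      with C that have "AE x in lebesgue_on \<Omega>. \<bar>u t x\<bar> \<le> C" by simp
      then show ?thesis by (rule AE_mp) auto
    qed
    show ?case unfolding P_def
      by (intro exI[of _ "max B C"] conjI ballI impI *) (use B(1) in simp)
  next
    case (local t)
    obtain d where d: "d > 0" "\<And>s. s \<ge> 0 \<Longrightarrow> \<bar>s - t\<bar> < d \<Longrightarrow>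
      AE x in lebesgue_on \<Omega>. \<bar>u s x - u t x - (s - t) * v t x\<bar> \<le> 1 * \<bar>s - t\<bar>"
      using u_diff[OF local(1) zero_less_one] by blast
    obtain V where V: "V > 0" "AE x in lebesgue_on \<Omega>. \<bar>v t x\<bar> \<le> V"
      using v_bounded[OF local(1)] by blast
    have "u t \<in> Linf \<Omega>" using C1 local by (simp add: C1_Linf_def)
    then obtain U where U: "U > 0" "AE x in lebesgue_on \<Omega>. \<bar>u t x\<bar> \<le> U"
      using Linf_imp_AE_bounded by blast
    have *: "AE x in lebesgue_on \<Omega>. \<bar>u s x\<bar> \<le> U + d * V + d" if "s \<ge> 0" "\<bar>s - t\<bar> < d" for s
      using d(2)[OF that] U(2) V(2)
    proof eventually_elim
      case (elim x)
      have "\<bar>(s - t) * v t x\<bar> \<le> d * V"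
        unfolding abs_mult using elim that by (intro mult_mono) auto
      moreover have "\<bar>a\<bar> \<le> U + D + d"
        if "\<bar>a - b - p\<bar> \<le> 1 * q" "\<bar>b\<bar> \<le> U" "\<bar>p\<bar> \<le> D" "q < d" for a b p q D :: real
        using that by linarith
      ultimately show ?case using elim that by blast
    qed
    have "U + d * V + d > 0" using U V d by (intro add_pos_pos mult_pos_pos)
    then have "P a b" if "a \<le> t \<and> t \<le> b \<and> b - a < d" for a b
      unfolding P_def
      by (intro exI[of _ "U + d * V + d"] conjI ballI impI *) (use that in \<open>auto simp: abs_if\<close>)
    then show ?case by (intro exI[of _ d] conjI allI impI d(1)) auto
  qed
  then obtain B where "B > 0" "\<forall>t\<in>{0..T}. t \<ge> 0 \<longrightarrow> (AE x in lebesgue_on \<Omega>. \<bar>u t x\<bar> \<le> B)"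
    unfolding P_def by blast
  then show ?thesis by (intro exI[of _ B] conjI ballI) simp_all
qed

text \<open>The space \<open>L\<^sup>\<infinity>\<close> is not available as a normed type, so this mean value inequality is proved
  by bisection instead of being instantiated.\<close>

lemma Linf_mean_value:
  assumes "0 \<le> s" "s \<le> t"
    and h: "\<And>r. r \<in> {s..t} \<Longrightarrow> AE x in lebesgue_on \<Omega>. \<bar>v r x - h x\<bar> \<le> c"
    and "e > 0"
  shows "AE x in lebesgue_on \<Omega>. \<bar>u t x - u s x - (t - s) * h x\<bar> \<le> (c + e) * (t - s)"
proof -
  \<comment> \<open>The trivial premises are the guards of the bisection predicate at the end
    points: only subintervals of [s,t] may be estimated, because \<open>h\<close> approximates
    \<open>v\<close> only there.\<close>
  have "s \<le> s \<longrightarrow> t \<le> t \<longrightarrow> s \<le> t \<longrightarrow>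
      (AE x in lebesgue_on \<Omega>. \<bar>u t x - u s x - (t - s) * h x\<bar> \<le> (c + e) * (t - s))"
    using \<open>s \<le> t\<close>
  proof (induction rule: Bolzano[where P = "\<lambda>a b. s \<le> a \<longrightarrow> b \<le> t \<longrightarrow> a \<le> b \<longrightarrow>
      (AE x in lebesgue_on \<Omega>. \<bar>u b x - u a x - (b - a) * h x\<bar> \<le> (c + e) * (b - a))"])
    case (trans a b d)
    show ?case
    proof (intro impI)
      assume "s \<le> a" "d \<le> t" "a \<le> d"
      with trans have "AE x in lebesgue_on \<Omega>. \<bar>u b x - u a x - (b - a) * h x\<bar> \<le> (c + e) * (b - a)"
        "AE x in lebesgue_on \<Omega>. \<bar>u d x - u b x - (d - b) * h x\<bar> \<le> (c + e) * (d - b)" by auto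
      then show "AE x in lebesgue_on \<Omega>. \<bar>u d x - u a x - (d - a) * h x\<bar> \<le> (c + e) * (d - a)"
      proof eventually_elim
        case (elim x)
        have "u d x - u a x - (d - a) * h x =
            (u b x - u a x - (b - a) * h x) + (u d x - u b x - (d - b) * h x)"
          "(c + e) * (d - a) = (c + e) * (b - a) + (c + e) * (d - b)"
          by (simp_all add: algebra_simps)
        with elim show ?case by linarith
      qed
    qed
  next
    case (local r)
    with \<open>0 \<le> s\<close> have "r \<ge> 0" by simp
    obtain d where d: "d > 0" "\<And>s. s \<ge> 0 \<Longrightarrow> \<bar>s - r\<bar> < d \<Longrightarrow>
      AE x in lebesgue_on \<Omega>. \<bar>u s x - u r x - (s - r) * v r x\<bar> \<le> e * \<bar>s - r\<bar>"
      using u_diff[OF \<open>r \<ge> 0\<close> \<open>e > 0\<close>] by blast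
    have "AE x in lebesgue_on \<Omega>. \<bar>u b x - u a x - (b - a) * h x\<bar> \<le> (c + e) * (b - a)"
      if ab: "a \<le> r" "r \<le> b" "b - a < d" "s \<le> a" "b \<le> t" for a b
    proof -
      have "AE x in lebesgue_on \<Omega>. \<bar>u a x - u r x - (a - r) * v r x\<bar> \<le> e * \<bar>a - r\<bar>"
        "AE x in lebesgue_on \<Omega>. \<bar>u b x - u r x - (b - r) * v r x\<bar> \<le> e * \<bar>b - r\<bar>"
        "AE x in lebesgue_on \<Omega>. \<bar>v r x - h x\<bar> \<le> c"
        by (rule d(2) h; use ab local \<open>0 \<le> s\<close> in simp)+
      then show ?thesis
      proof eventually_elim
        case (elim x)
        \<comment> \<open>Both end points are expanded about r. As r lies between them, the two
          remainders add up to e * (b - a), and replacing \<open>v r\<close> by \<open>h\<close>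
          costs c * (b - a).\<close>
        have "u b x - u a x - (b - a) * h x = (u b x - u r x - (b - r) * v r x)
            - (u a x - u r x - (a - r) * v r x) + (b - a) * (v r x - h x)"
          by (simp add: algebra_simps)
        moreover have "\<bar>(b - a) * (v r x - h x)\<bar> \<le> (b - a) * c"
          unfolding abs_mult using elim ab by (intro mult_mono) auto
        moreover have "e * \<bar>b - r\<bar> + e * \<bar>a - r\<bar> = e * (b - a)"
          using ab by (simp add: algebra_simps)
        moreover have "(c + e) * (b - a) = (b - a) * c + e * (b - a)" by (simp add: algebra_simps)
        ultimately show ?case using elim by linarith
      qed
    qed
    then show ?case by (intro exI[of _ d] conjI allI impI d(1)) auto
  qed
  from this[THEN mp, OF order_refl, THEN mp, OF order_refl, THEN mp, OF \<open>s \<le> t\<close>]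
  show ?thesis .
qed

text \<open>\<rho> is a Lebesgue number of a covering of [0,T] by balls on which \<open>v\<close>
  varies by at most e / 2 from the centre: two times closer than \<rho> share such a ball, and each
  is compared with its centre.\<close>

lemma v_uniformly_cont:
  assumes "e > 0"
  shows "\<exists>\<rho>>0. \<forall>s\<in>{0..T}. \<forall>t\<in>{0..T}. \<bar>s - t\<bar> < \<rho> \<longrightarrow>
    (AE x in lebesgue_on \<Omega>. \<bar>v s x - v t x\<bar> \<le> e)"
proof -
  have "\<forall>t\<in>{0..T}. \<exists>d>0. \<forall>s\<ge>0. \<bar>s - t\<bar> < d \<longrightarrow> (AE x in lebesgue_on \<Omega>. \<bar>v s x - v t x\<bar> \<le> e / 2)"
  proof
    fix t assume "t \<in> {0..T}"
    then show "\<exists>d>0. \<forall>s\<ge>0. \<bar>s - t\<bar> < d \<longrightarrow> (AE x in lebesgue_on \<Omega>. \<bar>v s x - v t x\<bar> \<le> e / 2)"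
      using v_cont[of t "e / 2"] \<open>e > 0\<close> by simp
  qed
  from bchoice[OF this] obtain d where d: "\<forall>t\<in>{0..T}. d t > 0 \<and>
      (\<forall>s\<ge>0. \<bar>s - t\<bar> < d t \<longrightarrow> (AE x in lebesgue_on \<Omega>. \<bar>v s x - v t x\<bar> \<le> e / 2))" ..
  have d0: "d t > 0" if "t \<in> {0..T}" for t
    using d that by blast
  obtain \<rho> where \<rho>: "\<rho> > 0"
    "\<forall>t\<in>{0..T}. \<exists>G\<in>(\<lambda>t. ball t (d t)) ` {0..T}. ball t \<rho> \<subseteq> G"
  proof (rule Heine_Borel_lemma[of "{0..T}" "(\<lambda>t. ball t (d t)) ` {0..T}"])
    show "{0..T} \<subseteq> \<Union> ((\<lambda>t. ball t (d t)) ` {0..T})"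
    proof
      fix t assume t: "t \<in> {0..T}"
      then have "t \<in> ball t (d t)" using d0 by simp
      with t show "t \<in> \<Union> ((\<lambda>t. ball t (d t)) ` {0..T})" by blast
    qed
  next
    fix \<rho> assume "0 < \<rho>" "\<And>t. t \<in> {0..T} \<Longrightarrow> \<exists>G\<in>(\<lambda>t. ball t (d t)) ` {0..T}. ball t \<rho> \<subseteq> G"
    then show thesis by (intro that[of \<rho>] ballI)
  qed auto
  have "AE x in lebesgue_on \<Omega>. \<bar>v s x - v t x\<bar> \<le> e"
    if st: "s \<in> {0..T}" "t \<in> {0..T}" "\<bar>s - t\<bar> < \<rho>" for s t
  proof -
    obtain r where r: "r \<in> {0..T}" "ball t \<rho> \<subseteq> ball r (d r)" using \<rho>(2) st(2) by blast
    have "s \<in> ball t \<rho>" "t \<in> ball t \<rho>" using st \<rho> by (auto simp: dist_real_def)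
    with r(2) have "s \<in> ball r (d r)" "t \<in> ball r (d r)" by blast+
    then have "\<bar>s - r\<bar> < d r" "\<bar>t - r\<bar> < d r" by (simp_all add: dist_real_def abs_minus_commute)
    then have "AE x in lebesgue_on \<Omega>. \<bar>v s x - v r x\<bar> \<le> e / 2"
      "AE x in lebesgue_on \<Omega>. \<bar>v t x - v r x\<bar> \<le> e / 2"
      using bspec[OF d r(1)] st by simp_all
    then show ?thesis by eventually_elim linarith
  qed
  then show ?thesis by (intro exI[of _ \<rho>] conjI ballI impI \<rho>(1))
qed

text \<open>The point is that \<rho> depends on e and T but not on s. This uniformity lets the
  estimate survive a restriction to rational times followed by a limit. In the mean value
  inequality, half of e pays for the variation of \<open>v\<close> and half is its slack.\<close>

lemma u_uniformly_diff:
  assumes "e > 0"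
  shows "\<exists>\<rho>>0. \<forall>s\<in>{0..T}. \<forall>t\<in>{0..T}. \<bar>t - s\<bar> < \<rho> \<longrightarrow>
    (AE x in lebesgue_on \<Omega>. \<bar>u t x - u s x - (t - s) * v s x\<bar> \<le> e * \<bar>t - s\<bar>)"
proof -
  obtain \<rho> where \<rho>: "\<rho> > 0" "\<And>s t. s \<in> {0..T} \<Longrightarrow> t \<in> {0..T} \<Longrightarrow> \<bar>s - t\<bar> < \<rho> \<Longrightarrow>
    AE x in lebesgue_on \<Omega>. \<bar>v s x - v t x\<bar> \<le> e / 2"
    using v_uniformly_cont[OF half_gt_zero[OF \<open>e > 0\<close>], of T] by blast
  have "AE x in lebesgue_on \<Omega>. \<bar>u t x - u s x - (t - s) * v s x\<bar> \<le> e * \<bar>t - s\<bar>"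
    if st: "s \<in> {0..T}" "t \<in> {0..T}" "\<bar>t - s\<bar> < \<rho>" for s t
  proof (cases "s \<le> t")
    case True
    have "AE x in lebesgue_on \<Omega>. \<bar>u t x - u s x - (t - s) * v s x\<bar> \<le> (e / 2 + e / 2) * (t - s)"
      proof (rule Linf_mean_value)
      show "AE x in lebesgue_on \<Omega>. \<bar>v r x - v s x\<bar> \<le> e / 2" if "r \<in> {s..t}" for r
        by (rule \<rho>(2)) (use st that in auto)
    qed (use st True \<open>e > 0\<close> in auto)
    with True show ?thesis by simp
  next
    case False
    \<comment> \<open>Same inequality on [t,s]; the comparison slope is still \<open>v s\<close>,
      now taken at the right end point.\<close>
    have "AE x in lebesgue_on \<Omega>. \<bar>u s x - u t x - (s - t) * v s x\<bar> \<le> (e / 2 + e / 2) * (s - t)"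
      proof (rule Linf_mean_value)
      show "AE x in lebesgue_on \<Omega>. \<bar>v r x - v s x\<bar> \<le> e / 2" if "r \<in> {t..s}" for r
        by (rule \<rho>(2)) (use st that in auto)
    qed (use st False \<open>e > 0\<close> in auto)
    then show ?thesis
    proof eventually_elim
      case (elim x)
      have "u t x - u s x - (t - s) * v s x = - (u s x - u t x - (s - t) * v s x)"
        by (simp add: algebra_simps)
      with elim False show ?case by simp
    qed
  qed
  then show ?thesis by (intro exI[of _ \<rho>] conjI ballI impI \<rho>(1))
qed

section \<open>Integrals along a curve and their time derivatives\<close>

lemma integrable_AE_bounded:
  fixes h :: "'a \<Rightarrow> real"
  assumes "h \<in> borel_measurable (lebesgue_on \<Omega>)" "AE x in lebesgue_on \<Omega>. \<bar>h x\<bar> \<le> c"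
  shows "integrable (lebesgue_on \<Omega>) h"
  using assms by (intro integrable_const_bound[where B = c]) auto

lemma integral_AE_bound:
  fixes h :: "'a \<Rightarrow> real"
  assumes "h \<in> borel_measurable (lebesgue_on \<Omega>)" "AE x in lebesgue_on \<Omega>. \<bar>h x\<bar> \<le> c"
  shows "\<bar>LINT x|lebesgue_on \<Omega>. h x\<bar> \<le> c * measure (lebesgue_on \<Omega>) \<Omega>"
proof -
  have "\<bar>LINT x|lebesgue_on \<Omega>. h x\<bar> \<le> (LINT x|lebesgue_on \<Omega>. \<bar>h x\<bar>)"
    by (rule integral_abs_bound)
  also have "\<dots> \<le> (LINT x|lebesgue_on \<Omega>. c)"
    using assms by (intro integral_mono_AE integrable_abs integrable_AE_bounded) auto
  finally show ?thesis by (simp add: mult.commute)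
qed

lemma integrable_comp_u:
  fixes \<psi> :: "real \<Rightarrow> real"
  assumes "continuous_on UNIV \<psi>" "t \<ge> 0"
  shows "integrable (lebesgue_on \<Omega>) (\<lambda>x. \<psi> (u t x))"
proof -
  obtain B where B: "AE x in lebesgue_on \<Omega>. \<bar>u t x\<bar> \<le> B" using u_bounded[OF \<open>t \<ge> 0\<close>] \<open>t \<ge> 0\<close> by fastforce
  have "compact (\<psi> ` {-B..B})"
    by (rule compact_continuous_image[OF continuous_on_subset[OF assms(1) subset_UNIV] compact_Icc])
  then obtain P where P: "\<And>z. z \<in> {-B..B} \<Longrightarrow> \<bar>\<psi> z\<bar> \<le> P"
    by (force simp: bounded_iff dest!: compact_imp_bounded)
  have "AE x in lebesgue_on \<Omega>. \<bar>\<psi> (u t x)\<bar> \<le> P" using B by eventually_elim (auto intro!: P)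
  moreover have "(\<lambda>x. \<psi> (u t x)) \<in> borel_measurable (lebesgue_on \<Omega>)"
    using assms by (intro borel_measurable_continuous_on[OF assms(1)]) auto
  ultimately show ?thesis by (intro integrable_AE_bounded)
qed

text \<open>Convergence in L-infinity gives |u s - u t| \<le> const |s - t| uniformly in x, so the
  quadratic remainder integrates to O(|s - t|^2). The hypothesis is a quadratic remainder rather
  than a second derivative, since it must also cover the truncated square of
  \<open>AE_lower_bound\<close>, which is C^1 but not C^2.\<close>

lemma deriv_integral_comp:
  fixes \<psi> \<psi>' :: "real \<Rightarrow> real"
  assumes cont: "continuous_on UNIV \<psi>" "continuous_on UNIV \<psi>'"
    and quad: "\<And>B. B > 0 \<Longrightarrow> \<exists>K\<ge>0. \<forall>a b. \<bar>a\<bar> \<le> B \<longrightarrow> \<bar>b\<bar> \<le> B \<longrightarrow>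
       \<bar>\<psi> a - \<psi> b - \<psi>' b * (a - b)\<bar> \<le> K * (a - b)\<^sup>2"
    and t: "t \<ge> 0"
  shows "((\<lambda>s. LINT x|lebesgue_on \<Omega>. \<psi> (u s x)) has_real_derivative
           (LINT x|lebesgue_on \<Omega>. \<psi>' (u t x) * v t x)) (at t within {0..})"
  unfolding has_field_derivative_iff Lim_within
proof (intro allI impI)
  fix e :: real assume "e > 0"
  obtain B where B: "B > 0" "\<And>s. s \<in> {0..t+1} \<Longrightarrow> AE x in lebesgue_on \<Omega>. \<bar>u s x\<bar> \<le> B"
    using u_bounded[OF add_nonneg_nonneg[OF t zero_le_one]] by blast
  obtain V where V: "V > 0" "AE x in lebesgue_on \<Omega>. \<bar>v t x\<bar> \<le> V" using v_bounded[OF t] by blast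
  obtain K where K: "K \<ge> 0" "\<And>a b. \<bar>a\<bar> \<le> B \<Longrightarrow> \<bar>b\<bar> \<le> B \<Longrightarrow>
       \<bar>\<psi> a - \<psi> b - \<psi>' b * (a - b)\<bar> \<le> K * (a - b)\<^sup>2"
    using quad[OF B(1)] by blast
  have "compact (\<psi>' ` {-B..B})"
    by (rule compact_continuous_image[OF continuous_on_subset[OF cont(2) subset_UNIV] compact_Icc])
  then obtain P where P: "\<And>z. z \<in> {-B..B} \<Longrightarrow> \<bar>\<psi>' z\<bar> \<le> P"
    by (force simp: bounded_iff dest!: compact_imp_bounded)
  have P0: "P \<ge> 0" using P[of 0] B by simp
  define m where "m = measure (lebesgue_on \<Omega>) \<Omega>"
  have "m \<ge> 0" by (simp add: m_def)
  \<comment> \<open>\<eta> is the accuracy of the linear approximation of \<open>u\<close>. It gets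
    multiplied by the bound P for \<psi>' and the measure m, and may cost e / 2; the added ones keep
    the denominator positive if P or m is 0. The cap 1 gives the increment bound (1 + V) |s - t|,
    hence the constant A below.\<close>
  define \<eta> where "\<eta> = min 1 (e / (2 * (P + 1) * (m + 1)))"
  have \<eta>: "\<eta> > 0" "\<eta> \<le> 1" "(P + 1) * \<eta> * (m + 1) \<le> e / 2"
  proof -
    show "\<eta> > 0" "\<eta> \<le> 1" using \<open>e > 0\<close> P0 \<open>m \<ge> 0\<close> by (auto simp: \<eta>_def)
    have "\<eta> \<le> e / (2 * (P + 1) * (m + 1))" by (simp add: \<eta>_def)
    moreover have "0 < 2 * (P + 1) * (m + 1)" using P0 \<open>m \<ge> 0\<close> by (intro mult_pos_pos) auto
    ultimately have "\<eta> * (2 * (P + 1) * (m + 1)) \<le> e" by (simp only: pos_le_divide_eq)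
    moreover have "\<eta> * (2 * (P + 1) * (m + 1)) = 2 * ((P + 1) * \<eta> * (m + 1))" by (simp only: mult_ac)
    ultimately show "(P + 1) * \<eta> * (m + 1) \<le> e / 2" by linarith
  qed
  define A where "A = K * (1 + V)\<^sup>2"
  have "A \<ge> 0" using K by (simp add: A_def)
  obtain d1 where d1: "d1 > 0" "\<And>s. s \<ge> 0 \<Longrightarrow> \<bar>s - t\<bar> < d1 \<Longrightarrow>
      AE x in lebesgue_on \<Omega>. \<bar>u s x - u t x - (s - t) * v t x\<bar> \<le> \<eta> * \<bar>s - t\<bar>"
    using u_diff[OF t \<eta>(1)] by blast
  \<comment> \<open>The cap 1 keeps s in [0, t + 1], where B bounds \<open>u\<close>; the last entry
    makes the quadratic remainder cost at most e / 2.\<close>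
  define d where "d = min (min d1 1) (e / (2 * (A + 1) * (m + 1)))"
  have d: "d > 0" "d \<le> d1" "d \<le> 1" "(A + 1) * d * (m + 1) \<le> e / 2"
  proof -
    show "d > 0" "d \<le> d1" "d \<le> 1" using \<open>e > 0\<close> \<open>A \<ge> 0\<close> \<open>m \<ge> 0\<close> d1 by (auto simp: d_def)
    have "d \<le> e / (2 * (A + 1) * (m + 1))" by (simp add: d_def)
    moreover have "0 < 2 * (A + 1) * (m + 1)" using \<open>A \<ge> 0\<close> \<open>m \<ge> 0\<close> by (intro mult_pos_pos) auto
    ultimately have "d * (2 * (A + 1) * (m + 1)) \<le> e" by (simp only: pos_le_divide_eq)
    moreover have "d * (2 * (A + 1) * (m + 1)) = 2 * ((A + 1) * d * (m + 1))" by (simp only: mult_ac)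
    ultimately show "(A + 1) * d * (m + 1) \<le> e / 2" by linarith
  qed
  have "dist (((LINT x|lebesgue_on \<Omega>. \<psi> (u s x)) - (LINT x|lebesgue_on \<Omega>. \<psi> (u t x))) / (s - t))
         (LINT x|lebesgue_on \<Omega>. \<psi>' (u t x) * v t x) < e"
    if s: "s \<ge> 0" "0 < \<bar>s - t\<bar>" "\<bar>s - t\<bar> < d" for s
  proof -
    have "AE x in lebesgue_on \<Omega>. \<bar>u s x - u t x - (s - t) * v t x\<bar> \<le> \<eta> * \<bar>s - t\<bar>"
      "AE x in lebesgue_on \<Omega>. \<bar>u s x\<bar> \<le> B" "AE x in lebesgue_on \<Omega>. \<bar>u t x\<bar> \<le> B"
      using s d t by (auto intro!: d1(2) B(2))
    with V(2) have bound: "AE x in lebesgue_on \<Omega>.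
      \<bar>\<psi> (u s x) - \<psi> (u t x) - (s - t) * (\<psi>' (u t x) * v t x)\<bar> \<le> (A * d + P * \<eta>) * \<bar>s - t\<bar>"
    proof eventually_elim
      case (elim x)
      have "\<bar>(s - t) * v t x\<bar> \<le> V * \<bar>s - t\<bar>"
        unfolding abs_mult mult.commute[of V] using elim by (intro mult_left_mono) auto
      moreover have "\<eta> * \<bar>s - t\<bar> \<le> 1 * \<bar>s - t\<bar>" using \<eta> by (intro mult_right_mono) auto
      ultimately have "\<bar>u s x - u t x\<bar> \<le> (1 + V) * \<bar>s - t\<bar>"
        unfolding distrib_right using elim by linarith
      then have "(u s x - u t x)\<^sup>2 \<le> ((1 + V) * \<bar>s - t\<bar>)\<^sup>2"
        using power_mono[OF _ abs_ge_zero, of "u s x - u t x" _ 2] by fastforce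
      then have "K * (u s x - u t x)\<^sup>2 \<le> K * ((1 + V) * \<bar>s - t\<bar>)\<^sup>2"
        using K by (intro mult_left_mono) auto
      also have "\<dots> = A * \<bar>s - t\<bar> * \<bar>s - t\<bar>"
        by (simp add: A_def power2_eq_square mult_ac)
      also have "\<dots> \<le> A * d * \<bar>s - t\<bar>"
        using s \<open>A \<ge> 0\<close> by (intro mult_right_mono mult_left_mono) auto
      finally have "\<bar>\<psi> (u s x) - \<psi> (u t x) - \<psi>' (u t x) * (u s x - u t x)\<bar> \<le> A * d * \<bar>s - t\<bar>"
        using K(2)[of "u s x" "u t x"] elim by linarith
      moreover have "\<bar>\<psi>' (u t x) * (u s x - u t x - (s - t) * v t x)\<bar> \<le> P * (\<eta> * \<bar>s - t\<bar>)"
        unfolding abs_mult using elim P0 P[of "u t x"] by (intro mult_mono) (auto simp: abs_le_iff)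
      moreover have "\<psi> (u s x) - \<psi> (u t x) - (s - t) * (\<psi>' (u t x) * v t x)
        = (\<psi> (u s x) - \<psi> (u t x) - \<psi>' (u t x) * (u s x - u t x))
          + \<psi>' (u t x) * (u s x - u t x - (s - t) * v t x)" by (simp add: algebra_simps)
      ultimately show ?case by (simp add: distrib_right mult.assoc)
    qed
    note [measurable] = measurable_u[OF t] measurable_u[OF s(1)] measurable_v[OF t]
      borel_measurable_continuous_onI[OF cont(1)] borel_measurable_continuous_onI[OF cont(2)]
    have "AE x in lebesgue_on \<Omega>. \<bar>\<psi>' (u t x) * v t x\<bar> \<le> P * V"
      using B(2)[of t] V(2)
    proof -
      have "AE x in lebesgue_on \<Omega>. \<bar>u t x\<bar> \<le> B" using B(2) t by auto
      then show ?thesis using V(2)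
        by eventually_elim (auto simp: abs_mult intro!: mult_mono P P0)
    qed
    then have i: "integrable (lebesgue_on \<Omega>) (\<lambda>x. \<psi>' (u t x) * v t x)"
      by (intro integrable_AE_bounded) measurable
    have "(LINT x|lebesgue_on \<Omega>. \<psi> (u s x) - \<psi> (u t x) - (s - t) * (\<psi>' (u t x) * v t x))
      = (LINT x|lebesgue_on \<Omega>. \<psi> (u s x)) - (LINT x|lebesgue_on \<Omega>. \<psi> (u t x))
        - (s - t) * (LINT x|lebesgue_on \<Omega>. \<psi>' (u t x) * v t x)"
      using i integrable_comp_u[OF cont(1)] s t by simp
    moreover have "\<bar>LINT x|lebesgue_on \<Omega>. \<psi> (u s x) - \<psi> (u t x) - (s - t) * (\<psi>' (u t x) * v t x)\<bar>
      \<le> (A * d + P * \<eta>) * \<bar>s - t\<bar> * m"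
      unfolding m_def by (rule integral_AE_bound[OF _ bound]) measurable
    moreover have "(A * d + P * \<eta>) * m < e"
    proof -
      have "A * d * m \<le> (A + 1) * d * (m + 1)"
        using \<open>A \<ge> 0\<close> \<open>m \<ge> 0\<close> d by (intro mult_mono) auto
      moreover have "0 \<le> P * \<eta>" "0 \<le> \<eta> * m" using P0 \<eta> \<open>m \<ge> 0\<close> by auto
      then have "P * \<eta> * m < (P + 1) * \<eta> * (m + 1)"
        using \<eta>(1) by (simp add: algebra_simps)
      ultimately show ?thesis using d(4) \<eta>(3) by (simp add: distrib_right)
    qed
    then have "(A * d + P * \<eta>) * \<bar>s - t\<bar> * m < e * \<bar>s - t\<bar>"
      using mult_strict_right_mono[of _ e "\<bar>s - t\<bar>"] s by (simp add: mult_ac)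
    ultimately have "\<bar>(LINT x|lebesgue_on \<Omega>. \<psi> (u s x)) - (LINT x|lebesgue_on \<Omega>. \<psi> (u t x))
        - (s - t) * (LINT x|lebesgue_on \<Omega>. \<psi>' (u t x) * v t x)\<bar> < e * \<bar>s - t\<bar>" by simp
    moreover have "(((LINT x|lebesgue_on \<Omega>. \<psi> (u s x)) - (LINT x|lebesgue_on \<Omega>. \<psi> (u t x)))
        - (s - t) * (LINT x|lebesgue_on \<Omega>. \<psi>' (u t x) * v t x)) / (s - t)
      = ((LINT x|lebesgue_on \<Omega>. \<psi> (u s x)) - (LINT x|lebesgue_on \<Omega>. \<psi> (u t x))) / (s - t)
        - (LINT x|lebesgue_on \<Omega>. \<psi>' (u t x) * v t x)"
      using s by (simp add: diff_divide_distrib)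
    ultimately show ?thesis
      using s by (metis abs_divide dist_real_def pos_divide_less_eq)
  qed
  with d show "\<exists>d>0. \<forall>s\<in>{0..}. 0 < dist s t \<and> dist s t < d \<longrightarrow>
      dist (((LINT x|lebesgue_on \<Omega>. \<psi> (u s x)) - (LINT x|lebesgue_on \<Omega>. \<psi> (u t x))) / (s - t))
         (LINT x|lebesgue_on \<Omega>. \<psi>' (u t x) * v t x) < e"
    by (auto simp: dist_real_def)
qed

end

section \<open>Sample paths\<close>

text \<open>The largest multiple of 1/(n+1) not exceeding max 0 t. For t \<ge> 0 the approximation
  is from below, so it never leaves [0,t]; the truncation keeps it nonnegative for every real t,
  hence inside the range where \<open>u\<close> is controlled.\<close>

definition grid :: "nat \<Rightarrow> real \<Rightarrow> real" where
  "grid n t = real_of_int \<lfloor>real (Suc n) * max 0 t\<rfloor> / real (Suc n)"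

lemma grid_in_Rats: "grid n t \<in> \<rat>"
  unfolding grid_def by (intro Rats_divide) auto

lemma grid_nonneg: "0 \<le> grid n t"
  unfolding grid_def by (intro divide_nonneg_nonneg) auto

lemma grid_le: "t \<ge> 0 \<Longrightarrow> grid n t \<le> t"
  unfolding grid_def by (simp add: divide_le_eq mult.commute del: of_nat_Suc)

lemma grid_tendsto:
  assumes "t \<ge> 0"
  shows "(\<lambda>n. grid n t) \<longlonglongrightarrow> t"
proof (rule real_tendsto_sandwich)
  show "\<forall>\<^sub>F n in sequentially. t - inverse (real (Suc n)) \<le> grid n t"
  proof (rule always_eventually, rule allI)
    fix n
    have "real (Suc n) * t - 1 \<le> real_of_int \<lfloor>real (Suc n) * t\<rfloor>" by linarith
    then have "(real (Suc n) * t - 1) / real (Suc n) \<le> grid n t"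
      unfolding grid_def using assms by (intro divide_right_mono) auto
    moreover have "(real (Suc n) * t - 1) / real (Suc n) = t - inverse (real (Suc n))"
      by (simp add: diff_divide_distrib inverse_eq_divide del: of_nat_Suc)
    ultimately show "t - inverse (real (Suc n)) \<le> grid n t" by simp
  qed
  show "\<forall>\<^sub>F n in sequentially. grid n t \<le> t"
    using grid_le[OF assms] by simp
  show "(\<lambda>n. t - inverse (real (Suc n))) \<longlonglongrightarrow> t"
    using tendsto_diff[OF tendsto_const LIMSEQ_inverse_real_of_nat, of t] by simp
qed simp

text \<open>A limit along a sequence rather than along all rationals: it involves countably many
  times, so applied pointwise in x it preserves measurability.\<close>

definition grid_lim :: "(real \<Rightarrow> real) \<Rightarrow> real \<Rightarrow> real" where
  "grid_lim U t = lim (\<lambda>n. U (grid n t))"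

text \<open>Almost every sample path is controlled at rational times only; its continuous extension
  inherits the estimate and hence solves the differential equation at every time.\<close>

lemma (in kinetics) trajectory_grid_lim:
  assumes diff: "\<And>k T :: nat. \<exists>\<rho>>0. \<forall>s\<in>\<rat> \<inter> {0..real T}. \<forall>t\<in>\<rat> \<inter> {0..real T}. \<bar>t - s\<bar> < \<rho> \<longrightarrow>
      \<bar>U t - U s - (t - s) * (g_react (U s) * (U s - l s))\<bar> \<le> inverse (real (Suc k)) * \<bar>t - s\<bar>"
    and bd: "\<And>T :: nat. \<exists>B>0. \<forall>s\<in>\<rat> \<inter> {0..real T}. \<bar>U s\<bar> \<le> B"
  shows "trajectory (grid_lim U)" (is ?traj)
    and "t \<ge> 0 \<Longrightarrow> (\<lambda>n. U (grid n t)) \<longlonglongrightarrow> grid_lim U t"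
proof -
  define F where "F s z = g_react z * (z - l s)" for s z
  have lip: "\<exists>\<rho>>0. \<exists>L>0. \<forall>s\<in>\<rat> \<inter> {0..real T}. \<forall>t\<in>\<rat> \<inter> {0..real T}. \<bar>t - s\<bar> < \<rho> \<longrightarrow>
      \<bar>U t - U s\<bar> \<le> L * \<bar>t - s\<bar>" for T :: nat
  proof -
    \<comment> \<open>The case k = 0, with tolerance 1, is enough for a local Lipschitz
      bound.\<close>
    obtain \<rho> where \<rho>: "\<rho> > 0" "\<forall>s\<in>\<rat> \<inter> {0..real T}. \<forall>t\<in>\<rat> \<inter> {0..real T}. \<bar>t - s\<bar> < \<rho> \<longrightarrow>
      \<bar>U t - U s - (t - s) * F s (U s)\<bar> \<le> 1 * \<bar>t - s\<bar>"
      using diff[of T 0] unfolding F_def by auto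
    obtain B where B: "B > 0" "\<forall>s\<in>\<rat> \<inter> {0..real T}. \<bar>U s\<bar> \<le> B" using bd by blast
    have "compact (l ` {0..real T})"
      by (rule compact_continuous_image[OF continuous_on_subset[OF l_cont] compact_Icc]) auto
    then obtain C where C: "\<And>s. s \<in> {0..real T} \<Longrightarrow> \<bar>l s\<bar> \<le> C"
      by (force simp: bounded_iff dest!: compact_imp_bounded)
    have C0: "C \<ge> 0" using C[of 0] by simp
    \<comment> \<open>The tolerance 1 plus a bound for |g(U) (U - l)| when |U| \<le> B and |l| \<le>
      C.\<close>
    define L where "L = 1 + B * (1 + B) * (B + C)"
    have "L > 0" unfolding L_def using B(1) C0 by (intro add_pos_nonneg mult_nonneg_nonneg) auto
    moreover have "\<bar>U t - U s\<bar> \<le> L * \<bar>t - s\<bar>"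
      if st: "s \<in> \<rat> \<inter> {0..real T}" "t \<in> \<rat> \<inter> {0..real T}" "\<bar>t - s\<bar> < \<rho>" for s t
    proof -
      have "\<bar>U s\<bar> \<le> B" "\<bar>l s\<bar> \<le> C" using B st C by auto
      then have "\<bar>F s (U s)\<bar> \<le> B * (1 + B) * (B + C)"
        unfolding F_def g_react_def abs_mult using B(1) by (intro mult_mono) auto
      then have "\<bar>(t - s) * F s (U s)\<bar> \<le> \<bar>t - s\<bar> * (B * (1 + B) * (B + C))"
        unfolding abs_mult by (intro mult_left_mono) auto
      moreover have "\<bar>U t - U s - (t - s) * F s (U s)\<bar> \<le> 1 * \<bar>t - s\<bar>" using \<rho> st by blast
      moreover have "L * \<bar>t - s\<bar> = 1 * \<bar>t - s\<bar> + \<bar>t - s\<bar> * (B * (1 + B) * (B + C))"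
        by (simp add: L_def algebra_simps)
      ultimately show ?thesis by linarith
    qed
    ultimately show ?thesis using \<rho>(1) by blast
  qed
  have grid_mem: "grid n t \<in> \<rat> \<inter> {0..real T}" if "0 \<le> t" "t \<le> real T" for n t T
    using grid_in_Rats[of n t] grid_nonneg[of n t] grid_le[of t n] that by simp
  have lim: "(\<lambda>n. U (grid n t)) \<longlonglongrightarrow> grid_lim U t" if t: "t \<ge> 0" for t
  proof -
    obtain T :: nat where T: "t \<le> real T" using real_arch_simple by blast
    obtain \<rho> L where \<rho>: "\<rho> > 0" "L > 0" "\<forall>s\<in>\<rat> \<inter> {0..real T}. \<forall>t\<in>\<rat> \<inter> {0..real T}. \<bar>t - s\<bar> < \<rho> \<longrightarrow>
      \<bar>U t - U s\<bar> \<le> L * \<bar>t - s\<bar>" using lip[of T] by blast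
    have "Cauchy (\<lambda>n. U (grid n t))"
    proof (rule metric_CauchyI)
      fix e :: real assume "e > 0"
      define d where "d = min \<rho> (e / L)"
      have "d > 0" using \<rho> \<open>e > 0\<close> by (simp add: d_def)
      have "Cauchy (\<lambda>n. grid n t)" using grid_tendsto[OF t] by (rule LIMSEQ_imp_Cauchy)
      then obtain N where N: "\<And>m n. m \<ge> N \<Longrightarrow> n \<ge> N \<Longrightarrow> dist (grid m t) (grid n t) < d"
        using \<open>d > 0\<close> unfolding Cauchy_def by blast
      have "dist (U (grid m t)) (U (grid n t)) < e" if "m \<ge> N" "n \<ge> N" for m n
      proof -
        have d: "\<bar>grid m t - grid n t\<bar> < d" using N[OF that] by (simp add: dist_real_def)
        then have "\<bar>U (grid m t) - U (grid n t)\<bar> \<le> L * \<bar>grid m t - grid n t\<bar>"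
          using \<rho>(3) grid_mem[OF t T] by (simp add: d_def)
        also have "\<dots> < L * d" using d \<rho>(2) by simp
        also have "\<dots> \<le> L * (e / L)" using \<rho>(2) by (intro mult_left_mono) (auto simp: d_def)
        also have "\<dots> = e" using \<rho>(2) by simp
        finally show ?thesis by (simp add: dist_real_def)
      qed
      then show "\<exists>N. \<forall>m\<ge>N. \<forall>n\<ge>N. dist (U (grid m t)) (U (grid n t)) < e" by blast
    qed
    then have "convergent (\<lambda>n. U (grid n t))" by (rule Cauchy_convergent)
    then show ?thesis unfolding grid_lim_def by (simp add: convergent_LIMSEQ_iff)
  qed
  then show "t \<ge> 0 \<Longrightarrow> (\<lambda>n. U (grid n t)) \<longlonglongrightarrow> grid_lim U t" .
  define W where "W = grid_lim U"
  \<comment> \<open>Continuity of \<open>l\<close> is what carries the right-hand side from rational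
    times to an arbitrary time.\<close>
  have F_lim: "(\<lambda>n. F (grid n s) (U (grid n s))) \<longlonglongrightarrow> F s (W s)" if "s \<ge> 0" for s
  proof -
    have "(\<lambda>n. l (grid n s)) \<longlonglongrightarrow> l s"
      using continuous_on_tendsto_compose[OF l_cont grid_tendsto[OF that]] that
      by (simp add: grid_nonneg)
    then show ?thesis
      unfolding F_def g_react_def W_def by (intro tendsto_intros lim that)
  qed
  show ?traj
    unfolding trajectory_def W_def[symmetric]
  proof (intro allI impI)
    fix t :: real assume t: "t \<ge> 0"
    have "(W has_real_derivative F t (W t)) (at t within {0..})"
      unfolding has_field_derivative_iff Lim_within
    proof (intro allI impI)
      fix e :: real assume "e > 0"
      then obtain k where k: "inverse (real (Suc k)) < e" using reals_Archimedean by blast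
      obtain T :: nat where T: "t + 1 \<le> real T" using real_arch_simple by blast
      obtain \<rho> where \<rho>: "\<rho> > 0" "\<forall>s\<in>\<rat> \<inter> {0..real T}. \<forall>t\<in>\<rat> \<inter> {0..real T}. \<bar>t - s\<bar> < \<rho> \<longrightarrow>
        \<bar>U t - U s - (t - s) * F s (U s)\<bar> \<le> inverse (real (Suc k)) * \<bar>t - s\<bar>"
        using diff[of T k] unfolding F_def by blast
      have "dist ((W s - W t) / (s - t)) (F t (W t)) < e"
        if s: "s \<ge> 0" "0 < \<bar>s - t\<bar>" "\<bar>s - t\<bar> < min 1 \<rho>" for s
      proof -
        have st: "s \<le> real T" "t \<le> real T" using s T by linarith+
        \<comment> \<open>The estimate is applied with rational base point \<open>grid n t\<close>
          and rational end point \<open>grid n s\<close>. Since |s - t| < \<rho> is strict, it is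
          available for all large n, and its non-strict inequality passes to the limit.\<close>
        have lim_diff: "(\<lambda>n. \<bar>grid n s - grid n t\<bar>) \<longlonglongrightarrow> \<bar>s - t\<bar>"
          by (intro tendsto_intros grid_tendsto t s)
        then have "\<forall>\<^sub>F n in sequentially. \<bar>grid n s - grid n t\<bar> < \<rho>"
          using s by (intro order_tendstoD(2)) auto
        then have "\<forall>\<^sub>F n in sequentially.
          \<bar>U (grid n s) - U (grid n t) - (grid n s - grid n t) * F (grid n t) (U (grid n t))\<bar>
            \<le> inverse (real (Suc k)) * \<bar>grid n s - grid n t\<bar>"
          by eventually_elim (use \<rho>(2) grid_mem[OF s(1) st(1)] grid_mem[OF t st(2)] in blast)
        moreover have "(\<lambda>n. \<bar>U (grid n s) - U (grid n t)
            - (grid n s - grid n t) * F (grid n t) (U (grid n t))\<bar>)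
          \<longlonglongrightarrow> \<bar>W s - W t - (s - t) * F t (W t)\<bar>"
          unfolding W_def by (intro tendsto_intros lim grid_tendsto F_lim[unfolded W_def] t s)
        moreover have "(\<lambda>n. inverse (real (Suc k)) * \<bar>grid n s - grid n t\<bar>)
            \<longlonglongrightarrow> inverse (real (Suc k)) * \<bar>s - t\<bar>"
          by (intro tendsto_intros lim_diff)
        ultimately have "\<bar>W s - W t - (s - t) * F t (W t)\<bar> \<le> inverse (real (Suc k)) * \<bar>s - t\<bar>"
          by (intro tendsto_le[OF sequentially_bot])
        also have "\<dots> < e * \<bar>s - t\<bar>" using k s by (intro mult_strict_right_mono)
        finally have "\<bar>(W s - W t - (s - t) * F t (W t)) / (s - t)\<bar> < e"
          using s by (simp add: pos_divide_less_eq)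
        moreover have "(W s - W t - (s - t) * F t (W t)) / (s - t) = (W s - W t) / (s - t) - F t (W t)"
          using s by (simp add: diff_divide_distrib)
        ultimately show ?thesis by (simp add: dist_real_def)
      qed
      then show "\<exists>d>0. \<forall>s\<in>{0..}. 0 < dist s t \<and> dist s t < d \<longrightarrow>
          dist ((W s - W t) / (s - t)) (F t (W t)) < e"
        using \<rho>(1) by (intro exI[of _ "min 1 \<rho>"]) (auto simp: dist_real_def)
    qed
    then show "(W has_real_derivative g_react (W t) * (W t - l t)) (at t within {0..})"
      by (simp add: F_def)
  qed
qed

section \<open>Solutions of the nonlocal equation\<close>

lemma f_minus_g: "f_react z - l * g_react z = g_react z * (z - l)"
  by (simp add: f_react_def g_react_def power2_eq_square algebra_simps)

lemma continuous_react: "continuous_on A f_react" "continuous_on A g_react"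
  unfolding f_react_def g_react_def by (intro continuous_intros)+

locale nonlocal_solution = C1_curve +
  assumes g_nonzero: "t \<ge> 0 \<Longrightarrow> (LINT x|lebesgue_on \<Omega>. g_react (u t x)) \<noteq> 0"
    and eq: "t \<ge> 0 \<Longrightarrow> AE x in lebesgue_on \<Omega>.
      v t x = f_react (u t x) - lam \<Omega> u t * g_react (u t x)"
begin

text \<open>Together with its companion for g this supplies the continuity of \<open>lam\<close>, on
  which the scalar theory rests.\<close>

lemma deriv_integral_f:
  assumes "t \<ge> 0"
  shows "((\<lambda>s. LINT x|lebesgue_on \<Omega>. f_react (u s x)) has_real_derivative
           (LINT x|lebesgue_on \<Omega>. (2 * u t x - 3 * (u t x)\<^sup>2) * v t x)) (at t within {0..})"
proof (rule deriv_integral_comp[where \<psi> = f_react and \<psi>' = "\<lambda>z. 2 * z - 3 * z\<^sup>2"])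
  fix B :: real assume "B > 0"
  show "\<exists>K\<ge>0. \<forall>a b. \<bar>a\<bar> \<le> B \<longrightarrow> \<bar>b\<bar> \<le> B \<longrightarrow>
      \<bar>f_react a - f_react b - (2 * b - 3 * b\<^sup>2) * (a - b)\<bar> \<le> K * (a - b)\<^sup>2"
  proof (intro exI[of _ "1 + 3 * B"] conjI allI impI)
    fix a b :: real assume ab: "\<bar>a\<bar> \<le> B" "\<bar>b\<bar> \<le> B"
    \<comment> \<open>Exact Taylor remainder of the cubic.\<close>
    have "f_react a - f_react b - (2 * b - 3 * b\<^sup>2) * (a - b) = (1 - a - 2 * b) * (a - b)\<^sup>2"
      by (simp add: f_react_def power2_eq_square algebra_simps)
    moreover have "\<bar>1 - a - 2 * b\<bar> \<le> 1 + 3 * B" using ab by linarith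
    ultimately show "\<bar>f_react a - f_react b - (2 * b - 3 * b\<^sup>2) * (a - b)\<bar> \<le> (1 + 3 * B) * (a - b)\<^sup>2"
      by (simp add: abs_mult mult_right_mono)
  qed (use \<open>B > 0\<close> in simp)
qed (auto intro!: continuous_intros continuous_react assms)

lemma deriv_integral_g:
  assumes "t \<ge> 0"
  shows "((\<lambda>s. LINT x|lebesgue_on \<Omega>. g_react (u s x)) has_real_derivative
           (LINT x|lebesgue_on \<Omega>. (1 - 2 * u t x) * v t x)) (at t within {0..})"
proof (rule deriv_integral_comp[where \<psi> = g_react and \<psi>' = "\<lambda>z. 1 - 2 * z"])
  fix B :: real
  have "g_react a - g_react b - (1 - 2 * b) * (a - b) = - ((a - b)\<^sup>2)" for a b
    by (simp add: g_react_def power2_eq_square algebra_simps)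
  then show "\<exists>K\<ge>0. \<forall>a b. \<bar>a\<bar> \<le> B \<longrightarrow> \<bar>b\<bar> \<le> B \<longrightarrow>
      \<bar>g_react a - g_react b - (1 - 2 * b) * (a - b)\<bar> \<le> K * (a - b)\<^sup>2"
    by (intro exI[of _ 1]) simp
qed (auto intro!: continuous_intros continuous_react assms)

lemma lam_continuous: "continuous_on {0..} (lam \<Omega> u)"
  unfolding lam_def
proof (intro continuous_on_divide)
  show "continuous_on {0..} (\<lambda>t. LINT x|lebesgue_on \<Omega>. f_react (u t x))"
    by (rule DERIV_continuous_on[OF deriv_integral_f]) simp
  show "continuous_on {0..} (\<lambda>t. LINT x|lebesgue_on \<Omega>. g_react (u t x))"
    by (rule DERIV_continuous_on[OF deriv_integral_g]) simp
qed (use g_nonzero in simp)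

sublocale kinetics "lam \<Omega> u"
  by unfold_locales (rule lam_continuous)

lemma integrable_react:
  assumes "t \<ge> 0"
  shows "integrable (lebesgue_on \<Omega>) (\<lambda>x. f_react (u t x))"
    and "integrable (lebesgue_on \<Omega>) (\<lambda>x. g_react (u t x))"
  using integrable_comp_u[OF continuous_react(1) assms] integrable_comp_u[OF continuous_react(2) assms] .

text \<open>The quotient \<open>lam\<close> is defined precisely so that the integrals of f(u) and
  of \<open>lam\<close> times g(u) cancel. Equivalently, \<open>lam\<close> is the mean of u with
  respect to the weight g(u).\<close>

lemma integral_rhs_zero:
  assumes "t \<ge> 0"
  shows "(LINT x|lebesgue_on \<Omega>. g_react (u t x) * (u t x - lam \<Omega> u t)) = 0"
proof -
  have "(LINT x|lebesgue_on \<Omega>. f_react (u t x) - lam \<Omega> u t * g_react (u t x))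
    = (LINT x|lebesgue_on \<Omega>. f_react (u t x)) - lam \<Omega> u t * (LINT x|lebesgue_on \<Omega>. g_react (u t x))"
    using integrable_react[OF assms] by simp
  also have "\<dots> = 0" using g_nonzero[OF assms] by (simp add: lam_def)
  finally show ?thesis by (simp only: f_minus_g)
qed

lemma mass_conserved:
  assumes "t \<ge> 0"
  shows "(LINT x|lebesgue_on \<Omega>. u t x) = (LINT x|lebesgue_on \<Omega>. u 0 x)"
proof -
  have "((\<lambda>s. LINT x|lebesgue_on \<Omega>. u s x) has_real_derivative 0) (at t within {0..})"
    if t: "t \<ge> 0" for t
  proof -
    have "((\<lambda>s. LINT x|lebesgue_on \<Omega>. u s x) has_real_derivative
        (LINT x|lebesgue_on \<Omega>. 1 * v t x)) (at t within {0..})"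
      by (rule deriv_integral_comp[where \<psi> = "\<lambda>z. z" and \<psi>' = "\<lambda>_. 1"])
        (auto intro!: continuous_intros exI[of _ 0] t)
    moreover have "(LINT x|lebesgue_on \<Omega>. 1 * v t x)
        = (LINT x|lebesgue_on \<Omega>. g_react (u t x) * (u t x - lam \<Omega> u t))"
    proof (rule integral_cong_AE)
      have [measurable]: "g_react \<in> borel_measurable borel"
        by (rule borel_measurable_continuous_onI[OF continuous_react(2)])
      show "(\<lambda>x. g_react (u t x) * (u t x - lam \<Omega> u t)) \<in> borel_measurable (lebesgue_on \<Omega>)"
        using t by measurable
      show "(\<lambda>x. 1 * v t x) \<in> borel_measurable (lebesgue_on \<Omega>)" using t by measurable
      show "AE x in lebesgue_on \<Omega>. 1 * v t x = g_react (u t x) * (u t x - lam \<Omega> u t)"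
        using eq[OF t] by eventually_elim (simp add: f_minus_g)
    qed
    ultimately show ?thesis using integral_rhs_zero[OF t] by simp
  qed
  then obtain c where "\<forall>t\<in>{0..}. (LINT x|lebesgue_on \<Omega>. u t x) = c"
    using has_field_derivative_zero_constant[of "{0::real..}" "\<lambda>s. LINT x|lebesgue_on \<Omega>. u s x"]
    by auto
  with assms show ?thesis by simp
qed

text \<open>A modification of \<open>u\<close> in the sense of stochastic processes: at each time it
  agrees with \<open>u t\<close> a.e., and outside a single null set its paths are
  trajectories.\<close>

definition w :: "real \<Rightarrow> 'a \<Rightarrow> real" where
  "w t x = grid_lim (\<lambda>s. u s x) t"

lemma measurable_w [measurable]: "w t \<in> borel_measurable (lebesgue_on \<Omega>)"
  unfolding w_def grid_lim_def
  by (rule borel_measurable_lim_metric) (auto intro: measurable_u grid_nonneg)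

text \<open>The increment estimates, the bounds and the equation at rational times are countably
  many a.e. statements. Off the union of their null sets the path satisfies all premises of
  \<open>trajectory_grid_lim\<close>.\<close>

lemma AE_trajectory:
  "AE x in lebesgue_on \<Omega>. trajectory (\<lambda>t. w t x) \<and> (\<forall>t\<ge>0. (\<lambda>n. u (grid n t) x) \<longlonglongrightarrow> w t x)"
proof -
  define good where "good k T \<rho> \<longleftrightarrow> \<rho> > 0 \<and> (\<forall>s\<in>{0..real T}. \<forall>t\<in>{0..real T}. \<bar>t - s\<bar> < \<rho> \<longrightarrow>
    (AE x in lebesgue_on \<Omega>. \<bar>u t x - u s x - (t - s) * v s x\<bar> \<le> inverse (real (Suc k)) * \<bar>t - s\<bar>))"
    for k T :: nat and \<rho> :: real
  have "\<exists>\<rho>. good k T \<rho>" for k T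
    unfolding good_def by (rule u_uniformly_diff) simp
  \<comment> \<open>The radii, like the bounds B below, are fixed before x is, so the exceptional
    sets are indexed by k, T and rational times only.\<close>
  then obtain \<rho> where good: "good k T (\<rho> k T)" for k T by metis
  have \<rho>: "\<rho> k T > 0" for k T
    using good unfolding good_def by blast
  define bound where "bound T B \<longleftrightarrow> B > 0 \<and> (\<forall>t\<in>{0..real T}. AE x in lebesgue_on \<Omega>. \<bar>u t x\<bar> \<le> B)"
    for T :: nat and B :: real
  have "\<exists>B. bound T B" for T
    unfolding bound_def by (rule u_bounded) simp
  then obtain B where bound: "bound T (B T)" for T by metis
  have countable: "countable (\<rat> \<inter> {0..real T})" for T
    by (intro countable_Int1 countable_rat)
  have 1: "AE x in lebesgue_on \<Omega>. \<forall>k T. \<forall>s\<in>\<rat> \<inter> {0..real T}. \<forall>t\<in>\<rat> \<inter> {0..real T}.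
      \<bar>t - s\<bar> < \<rho> k T \<longrightarrow>
      \<bar>u t x - u s x - (t - s) * v s x\<bar> \<le> inverse (real (Suc k)) * \<bar>t - s\<bar>"
    unfolding AE_all_countable AE_ball_countable[OF countable]
  proof (intro allI ballI)
    fix k T s t assume "s \<in> \<rat> \<inter> {0..real T}" "t \<in> \<rat> \<inter> {0..real T}"
    then show "AE x in lebesgue_on \<Omega>. \<bar>t - s\<bar> < \<rho> k T \<longrightarrow>
      \<bar>u t x - u s x - (t - s) * v s x\<bar> \<le> inverse (real (Suc k)) * \<bar>t - s\<bar>"
      using good[of k T] by (cases "\<bar>t - s\<bar> < \<rho> k T") (simp_all add: good_def)
  qed
  have 2: "AE x in lebesgue_on \<Omega>. \<forall>T. \<forall>s\<in>\<rat> \<inter> {0..real T}. \<bar>u s x\<bar> \<le> B T"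
    unfolding AE_all_countable AE_ball_countable[OF countable] using bound by (simp add: bound_def)
  have 3: "AE x in lebesgue_on \<Omega>. \<forall>T. \<forall>s\<in>\<rat> \<inter> {0..real T}.
      v s x = g_react (u s x) * (u s x - lam \<Omega> u s)"
    unfolding AE_all_countable AE_ball_countable[OF countable] f_minus_g[symmetric] using eq by simp
  from 1 2 3 show ?thesis
  proof eventually_elim
    case (elim x)
    have a: "\<exists>r>0. \<forall>s\<in>\<rat> \<inter> {0..real T}. \<forall>t\<in>\<rat> \<inter> {0..real T}. \<bar>t - s\<bar> < r \<longrightarrow>
        \<bar>u t x - u s x - (t - s) * (g_react (u s x) * (u s x - lam \<Omega> u s))\<bar>
          \<le> inverse (real (Suc k)) * \<bar>t - s\<bar>" for k T
    proof (intro exI[of _ "\<rho> k T"] conjI \<rho> ballI impI)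
      fix s t assume "s \<in> \<rat> \<inter> {0..real T}" "t \<in> \<rat> \<inter> {0..real T}" "\<bar>t - s\<bar> < \<rho> k T"
      then have "v s x = g_react (u s x) * (u s x - lam \<Omega> u s)"
        "\<bar>u t x - u s x - (t - s) * v s x\<bar> \<le> inverse (real (Suc k)) * \<bar>t - s\<bar>"
        using elim by blast+
      then show "\<bar>u t x - u s x - (t - s) * (g_react (u s x) * (u s x - lam \<Omega> u s))\<bar>
          \<le> inverse (real (Suc k)) * \<bar>t - s\<bar>" by simp
    qed
    have b: "\<exists>B>0. \<forall>s\<in>\<rat> \<inter> {0..real T}. \<bar>u s x\<bar> \<le> B" for T
      using elim(2) bound by (intro exI[of _ "B T"]) (simp add: bound_def)
    show ?case
      using trajectory_grid_lim[of "\<lambda>s. u s x", OF a b] unfolding w_def by simp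
  qed
qed

text \<open>For a fixed t, possibly irrational, differentiability at t is used along the sequence
  \<open>grid n t\<close>, which again costs countably many null sets. It shows that the values on
  the grid also converge to \<open>u t x\<close>, and limits are unique.\<close>

lemma AE_w_eq:
  assumes t: "t \<ge> 0"
  shows "AE x in lebesgue_on \<Omega>. w t x = u t x"
proof -
  obtain V where V: "V > 0" "AE x in lebesgue_on \<Omega>. \<bar>v t x\<bar> \<le> V" using v_bounded[OF t] by blast
  obtain d where d: "d > 0" "\<And>s. s \<ge> 0 \<Longrightarrow> \<bar>s - t\<bar> < d \<Longrightarrow>
    AE x in lebesgue_on \<Omega>. \<bar>u s x - u t x - (s - t) * v t x\<bar> \<le> 1 * \<bar>s - t\<bar>"
    using u_diff[OF t zero_less_one] by blast
  have "AE x in lebesgue_on \<Omega>. \<forall>n. \<bar>grid n t - t\<bar> < d \<longrightarrow>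
      \<bar>u (grid n t) x - u t x - (grid n t - t) * v t x\<bar> \<le> 1 * \<bar>grid n t - t\<bar>"
    unfolding AE_all_countable
  proof
    fix n
    show "AE x in lebesgue_on \<Omega>. \<bar>grid n t - t\<bar> < d \<longrightarrow>
      \<bar>u (grid n t) x - u t x - (grid n t - t) * v t x\<bar> \<le> 1 * \<bar>grid n t - t\<bar>"
      using d(2)[OF grid_nonneg, of n t] by (cases "\<bar>grid n t - t\<bar> < d") simp_all
  qed
  with AE_trajectory show ?thesis
  proof eventually_elim
    case (elim x)
    have g: "(\<lambda>n. grid n t - t) \<longlonglongrightarrow> 0" using grid_tendsto[OF t] by (simp add: LIM_zero)
    have "(\<lambda>n. \<bar>grid n t - t\<bar>) \<longlonglongrightarrow> 0" using tendsto_rabs[OF g] by simp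
    moreover from this have "\<forall>\<^sub>F n in sequentially. \<bar>grid n t - t\<bar> < d"
      using d(1) by (rule order_tendstoD(2))
    then have "\<forall>\<^sub>F n in sequentially.
        norm (u (grid n t) x - u t x - (grid n t - t) * v t x) \<le> \<bar>grid n t - t\<bar>"
      by eventually_elim (use elim in simp)
    ultimately have "(\<lambda>n. u (grid n t) x - u t x - (grid n t - t) * v t x) \<longlonglongrightarrow> 0"
      by (rule Lim_null_comparison[rotated])
    from tendsto_add[OF this tendsto_add[OF tendsto_const[of "u t x"] tendsto_mult_right[OF g, of "v t x"]]]
    have "(\<lambda>n. u (grid n t) x) \<longlonglongrightarrow> u t x" by (simp add: algebra_simps)
    with elim t show ?case by (auto dest: LIMSEQ_unique)
  qed
qed

end

section \<open>Nonpositive data: bounds and long-time behaviour\<close>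

locale nonpositive_solution = nonlocal_solution +
  fixes M :: real
  assumes init_nonpos: "AE x in lebesgue_on \<Omega>. u 0 x \<le> 0"
    and init_bounded: "AE x in lebesgue_on \<Omega>. - M \<le> u 0 x"
    and M_pos: "M > 0"
begin

text \<open>The sign is preserved along the paths of \<open>w\<close>, which agree a.e. with
  \<open>u\<close> at the two times 0 and t.\<close>

lemma AE_nonpos:
  assumes "t \<ge> 0"
  shows "AE x in lebesgue_on \<Omega>. u t x \<le> 0"
  using AE_trajectory AE_w_eq[OF order_refl] AE_w_eq[OF assms] init_nonpos
proof eventually_elim
  case (elim x)
  then obtain k where "k > 0" "w t x = k * w 0 x"
    using trajectory_sign[of "\<lambda>t. w t x" t] assms by blast
  with elim show ?case using mult_nonneg_nonpos[of k "w 0 x"] by simp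
qed

lemma g_nonpos: "z \<le> 0 \<Longrightarrow> g_react z \<le> 0"
  unfolding g_react_def by (intro mult_nonpos_nonneg) auto

text \<open>Since \<open>\<lambda>(t)\<close> is the mean of \<open>u\<close> with respect to the weight \<open>\<bar>g(u)\<bar>\<close>, the integral of
  every convex function of \<open>u\<close> decreases. Applied to \<open>z \<mapsto> (max 0 (- M - z))\<^sup>2\<close> this gives the
  lower bound.\<close>

lemma AE_lower_bound:
  assumes "t \<ge> 0"
  shows "AE x in lebesgue_on \<Omega>. - M \<le> u t x"
proof -
  define \<psi> where "\<psi> z = (max 0 (- M - z))\<^sup>2" for z :: real
  define \<psi>' where "\<psi>' z = - 2 * max 0 (- M - z)" for z :: real
  have cont: "continuous_on UNIV \<psi>" "continuous_on UNIV \<psi>'"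
    unfolding \<psi>_def \<psi>'_def by (intro continuous_intros)+
  \<comment> \<open>\<psi> has no second derivative at -M. In the variables p, q below, the four
    sign cases give the remainder bound with constant 1.\<close>
  have quad: "\<bar>\<psi> a - \<psi> b - \<psi>' b * (a - b)\<bar> \<le> 1 * (a - b)\<^sup>2" for a b
  proof -
    define p q where "p = - M - a" and "q = - M - b"
    have ab: "a - b = q - p" by (simp add: p_def q_def)
    consider "p \<le> 0" "q \<le> 0" | "p > 0" "q > 0" | "p > 0" "q \<le> 0" | "p \<le> 0" "q > 0" by linarith
    then have "\<bar>(max 0 p)\<^sup>2 - (max 0 q)\<^sup>2 + 2 * max 0 q * (q - p)\<bar> \<le> (q - p)\<^sup>2"
    proof cases
      case 2
      have "p\<^sup>2 - q\<^sup>2 + 2 * q * (q - p) = (q - p)\<^sup>2"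
        by (simp add: power2_eq_square algebra_simps)
      with 2 show ?thesis by simp
    next
      case 3
      then have "q * p \<le> 0" by (intro mult_nonpos_nonneg) auto
      then have "0 \<le> q\<^sup>2 - 2 * q * p" using zero_le_power2[of q] by linarith
      with 3 show ?thesis by (simp add: power2_diff)
    next
      case 4
      then have "q * p \<le> 0" by (intro mult_nonneg_nonpos) auto
      then have "0 \<le> q\<^sup>2 - 2 * q * p" using zero_le_power2[of q] by linarith
      with 4 show ?thesis by (simp add: power2_eq_square algebra_simps)
    qed simp
    then show ?thesis by (simp add: \<psi>_def \<psi>'_def p_def[symmetric] q_def[symmetric] ab)
  qed
  have [measurable]: "\<psi>' \<in> borel_measurable borel" "g_react \<in> borel_measurable borel"
    by (intro borel_measurable_continuous_onI cont continuous_react)+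
  define \<Phi> where "\<Phi> t = (LINT x|lebesgue_on \<Omega>. \<psi> (u t x))" for t
  have \<Phi>': "(\<Phi> has_real_derivative (LINT x|lebesgue_on \<Omega>. \<psi>' (u t x) * v t x)) (at t within {0..})"
    if "t \<ge> 0" for t
    unfolding \<Phi>_def by (rule deriv_integral_comp[OF cont _ that]) (use quad in \<open>auto intro!: exI[of _ 1]\<close>)
  have neg: "(LINT x|lebesgue_on \<Omega>. \<psi>' (u t x) * v t x) \<le> 0" if t: "t \<ge> 0" for t
  proof -
    let ?l = "lam \<Omega> u t"
    have int: "integrable (lebesgue_on \<Omega>) (\<lambda>x. \<phi> (u t x))" if "continuous_on UNIV \<phi>" for \<phi> :: "real \<Rightarrow> real"
      using integrable_comp_u[OF that t] .
    have c: "continuous_on UNIV (\<lambda>z. \<psi>' z * (g_react z * (z - ?l)))"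
      "continuous_on UNIV (\<lambda>z. g_react z * (z - ?l))"
      by (intro continuous_intros cont continuous_react)+
    have "(LINT x|lebesgue_on \<Omega>. \<psi>' (u t x) * v t x)
        = (LINT x|lebesgue_on \<Omega>. \<psi>' (u t x) * (g_react (u t x) * (u t x - ?l)))"
    proof (rule integral_cong_AE)
      show "(\<lambda>x. \<psi>' (u t x) * (g_react (u t x) * (u t x - ?l))) \<in> borel_measurable (lebesgue_on \<Omega>)"
        using t by measurable
      show "(\<lambda>x. \<psi>' (u t x) * v t x) \<in> borel_measurable (lebesgue_on \<Omega>)" using t by measurable
      show "AE x in lebesgue_on \<Omega>. \<psi>' (u t x) * v t x = \<psi>' (u t x) * (g_react (u t x) * (u t x - ?l))"
        using eq[OF t] by eventually_elim (simp add: f_minus_g)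
    qed
    \<comment> \<open>\<psi>'(u) is replaced by the constant \<psi>'(\<lambda>): \<psi>' is
      nondecreasing, so (\<psi>'(u) - \<psi>'(\<lambda>)) (u - \<lambda>) \<ge> 0, and g(u) \<le> 0.
      A constant in this place leaves a multiple of the vanishing integral of the right-hand
      side.\<close>
    also have "\<dots> \<le> (LINT x|lebesgue_on \<Omega>. \<psi>' ?l * (g_react (u t x) * (u t x - ?l)))"
    proof (rule integral_mono_AE)
      show "AE x in lebesgue_on \<Omega>. \<psi>' (u t x) * (g_react (u t x) * (u t x - ?l))
          \<le> \<psi>' ?l * (g_react (u t x) * (u t x - ?l))"
        using AE_nonpos[OF t]
      proof eventually_elim
        case (elim x)
        have "(\<psi>' (u t x) - \<psi>' ?l) * (u t x - ?l) \<ge> 0"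
          by (cases "u t x \<le> ?l")
            (auto simp: \<psi>'_def max_def intro: mult_nonpos_nonpos mult_nonneg_nonneg)
        then have "g_react (u t x) * ((\<psi>' (u t x) - \<psi>' ?l) * (u t x - ?l)) \<le> 0"
          using g_nonpos[OF elim] by (intro mult_nonpos_nonneg)
        then show ?case by (simp add: algebra_simps)
      qed
    qed (use int[OF c(1)] int[OF c(2)] in simp_all)
    also have "\<dots> = 0" using integral_rhs_zero[OF t] by simp
    finally show ?thesis .
  qed
  have "\<Phi> 0 = 0"
  proof -
    have "AE x in lebesgue_on \<Omega>. \<psi> (u 0 x) = 0"
      using init_bounded by eventually_elim (simp add: \<psi>_def)
    then show ?thesis unfolding \<Phi>_def by (rule integral_eq_zero_AE)
  qed
  then have "\<Phi> t \<le> 0" using antimono_half_line[OF \<Phi>' neg order_refl assms] by simp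
  moreover have "\<Phi> t \<ge> 0" unfolding \<Phi>_def by (rule integral_nonneg_AE) (simp add: \<psi>_def)
  ultimately have "\<Phi> t = 0" by simp
  then have "AE x in lebesgue_on \<Omega>. \<psi> (u t x) = 0"
    unfolding \<Phi>_def using integrable_comp_u[OF cont(1) assms]
    by (subst (asm) integral_nonneg_eq_0_iff_AE) (auto simp: \<psi>_def)
  then show ?thesis by eventually_elim (simp add: \<psi>_def max_def split: if_splits)
qed

text \<open>From f(u) = u g(u) and -M \<le> u \<le> 0 follows |f(u)| \<le> M |g(u)|. As g(u) has
  constant sign, the integral of |g(u)| is the absolute value of the denominator.\<close>

lemma lam_bounded:
  assumes "t \<ge> 0"
  shows "\<bar>lam \<Omega> u t\<bar> \<le> M"
proof -
  let ?g = "LINT x|lebesgue_on \<Omega>. g_react (u t x)"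
  have "\<bar>LINT x|lebesgue_on \<Omega>. f_react (u t x)\<bar> \<le> (LINT x|lebesgue_on \<Omega>. \<bar>f_react (u t x)\<bar>)"
    by (rule integral_abs_bound)
  also have "\<dots> \<le> (LINT x|lebesgue_on \<Omega>. - M * g_react (u t x))"
  proof (rule integral_mono_AE)
    show "AE x in lebesgue_on \<Omega>. \<bar>f_react (u t x)\<bar> \<le> - M * g_react (u t x)"
      using AE_nonpos[OF assms] AE_lower_bound[OF assms]
    proof eventually_elim
      case (elim x)
      have "f_react (u t x) = u t x * g_react (u t x)"
        by (simp add: f_react_def g_react_def power2_eq_square)
      then have "\<bar>f_react (u t x)\<bar> = - u t x * - g_react (u t x)"
        using elim g_nonpos[OF elim(1)] by (simp add: abs_mult)
      also have "\<dots> \<le> M * - g_react (u t x)"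
        using elim g_nonpos[OF elim(1)] by (intro mult_right_mono) auto
      finally show ?case by simp
    qed
  qed (use integrable_react[OF assms] in auto)
  also have "\<dots> = M * - ?g" by simp
  also have "\<dots> \<le> M * \<bar>?g\<bar>" using M_pos by (intro mult_left_mono) auto
  finally show ?thesis
    using g_nonzero[OF assms] by (simp add: lam_def divide_le_eq)
qed

text \<open>The bounds for \<open>u\<close> hold at all rational times off one null set and pass to
  the limit that defines \<open>w\<close>; thus a single null set serves all times.\<close>

lemma AE_w_bounds: "AE x in lebesgue_on \<Omega>. \<forall>t\<ge>0. - M \<le> w t x \<and> w t x \<le> 0"
proof -
  have "AE x in lebesgue_on \<Omega>. \<forall>s\<in>\<rat> \<inter> {0..}. - M \<le> u s x \<and> u s x \<le> 0"
    by (subst AE_ball_countable) (auto intro!: countable_Int1 countable_rat AE_nonpos AE_lower_bound)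
  with AE_trajectory show ?thesis
  proof eventually_elim
    case (elim x)
    show ?case
    proof (intro allI impI)
      fix t :: real assume "t \<ge> 0"
      with elim have lim: "(\<lambda>n. u (grid n t) x) \<longlonglongrightarrow> w t x" by blast
      have "- M \<le> u (grid n t) x" "u (grid n t) x \<le> 0" for n
        using elim grid_in_Rats[of n t] grid_nonneg[of n t] by auto
      then show "- M \<le> w t x \<and> w t x \<le> 0"
        using LIMSEQ_le_const[OF lim] LIMSEQ_le_const2[OF lim] by blast
    qed
  qed
qed

text \<open>Every path minus the indicator of S times one reference path Z tends to 0. Integrating
  turns this into m - |S| Z(t) \<rightarrow> 0, where m is the conserved mass, so Z itself converges
  and all paths starting in S follow it. S is given only up to a null set because \<open>u 0\<close>
  and the initial datum agree only a.e.\<close>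

lemma w_converges:
  assumes S: "S \<in> sets (lebesgue_on \<Omega>)" "AE x in lebesgue_on \<Omega>. x \<in> S \<longleftrightarrow> u 0 x < 0"
    and nz: "\<not> (AE x in lebesgue_on \<Omega>. u 0 x = 0)"
  shows "\<exists>\<Lambda>. \<Lambda> < 0 \<and> measure (lebesgue_on \<Omega>) S \<noteq> 0 \<and>
    \<Lambda> * measure (lebesgue_on \<Omega>) S = (LINT x|lebesgue_on \<Omega>. u 0 x) \<and>
    (AE x in lebesgue_on \<Omega>. ((\<lambda>t. w t x) \<longlongrightarrow> \<Lambda> * indicator S x) at_top)"
proof -
  let ?A = "measure (lebesgue_on \<Omega>) S"
  let ?m = "LINT x|lebesgue_on \<Omega>. u 0 x"
  have [measurable]: "S \<in> sets (lebesgue_on \<Omega>)" by (rule S)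
  have int_u: "integrable (lebesgue_on \<Omega>) (u t)" if "t \<ge> 0" for t
    using integrable_comp_u[of "\<lambda>z. z", OF _ that] by simp
  define good where "good x \<longleftrightarrow> trajectory (\<lambda>t. w t x) \<and>
    (\<forall>t\<ge>0. - M \<le> w t x \<and> w t x \<le> 0) \<and> w 0 x = u 0 x \<and> u 0 x \<le> 0 \<and> (x \<in> S \<longleftrightarrow> u 0 x < 0)" for x
  have good: "AE x in lebesgue_on \<Omega>. good x"
    using AE_trajectory AE_w_bounds AE_w_eq[OF order_refl] init_nonpos S(2)
    by eventually_elim (simp add: good_def)
  \<comment> \<open>If no good point had a negative initial value, the datum would vanish
    a.e.\<close>
  obtain x\<^sub>0 where x0: "good x\<^sub>0" "u 0 x\<^sub>0 < 0"
  proof -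
    have False if "\<And>x. good x \<Longrightarrow> \<not> u 0 x < 0"
    proof -
      have "AE x in lebesgue_on \<Omega>. u 0 x = 0"
        using good by eventually_elim (use that in \<open>force simp: good_def\<close>)
      with nz show False by simp
    qed
    with that show thesis by blast
  qed
  define Z where "Z t = w t x\<^sub>0" for t
  have neg: "w t x < 0" if x: "good x" "u 0 x < 0" and t: "t \<ge> 0" for x t
  proof -
    have "trajectory (\<lambda>t. w t x)" using x by (simp add: good_def)
    then obtain k where "k > 0" "w t x = k * w 0 x" using t by (rule trajectory_sign)
    with x show ?thesis by (simp add: good_def mult_pos_neg)
  qed
  have merge: "((\<lambda>t. w t x - indicator S x * Z t) \<longlongrightarrow> 0) at_top" if x: "good x" for x
  proof (cases "x \<in> S")
    case True
    with x have "u 0 x < 0" by (simp add: good_def)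
    have "((\<lambda>t. w t x - w t x\<^sub>0) \<longlongrightarrow> 0) at_top"
    proof (rule trajectories_merge)
      show "trajectory (\<lambda>t. w t x)" "trajectory (\<lambda>t. w t x\<^sub>0)"
        using x x0(1) by (simp_all add: good_def)
      show "- M \<le> w t x \<and> w t x < 0" if "t \<ge> 0" for t
        using neg[OF x \<open>u 0 x < 0\<close> that] x that by (simp add: good_def)
      show "- M \<le> w t x\<^sub>0 \<and> w t x\<^sub>0 < 0" if "t \<ge> 0" for t
        using neg[OF x0 that] x0(1) that by (simp add: good_def)
    qed (rule lam_bounded)
    with True show ?thesis by (simp add: Z_def)
  next
    case False
    with x have 0: "w 0 x = 0" and "trajectory (\<lambda>t. w t x)" by (auto simp: good_def)
    then have "w t x = 0" if "t \<ge> 0" for t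
      using trajectory_sign[of "\<lambda>t. w t x" t] that by fastforce
    then have "\<forall>\<^sub>F t in at_top. w t x - indicator S x * Z t = 0"
      using False by (intro eventually_mono[OF eventually_ge_at_top[of 0]]) simp
    then show ?thesis by (rule tendsto_eventually)
  qed
  have int_S: "integrable (lebesgue_on \<Omega>) (indicat_real S)"
    by (rule integrable_AE_bounded[where c = 1]) (simp_all add: indicator_def S)
  have mass: "(LINT x|lebesgue_on \<Omega>. w t x - indicator S x * Z t) = ?m - ?A * Z t" if t: "t \<ge> 0" for t
  proof -
    have "(LINT x|lebesgue_on \<Omega>. w t x - indicator S x * Z t)
        = (LINT x|lebesgue_on \<Omega>. u t x - indicator S x * Z t)"
      by (rule integral_cong_AE) (use AE_w_eq[OF t] measurable_u[OF t] in auto)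
    also have "\<dots> = (LINT x|lebesgue_on \<Omega>. u t x) - (LINT x|lebesgue_on \<Omega>. indicator S x * Z t)"
      by (rule Bochner_Integration.integral_diff[OF int_u[OF t]]) (simp add: int_S)
    also have "(LINT x|lebesgue_on \<Omega>. indicator S x * Z t) = ?A * Z t"
      using sets.sets_into_space[OF S(1)] by (simp add: Int_absorb1 Int_absorb2)
    finally show ?thesis using mass_conserved[OF t] by simp
  qed
  have Z_bd: "\<bar>Z t\<bar> \<le> M" if "t \<ge> 0" for t
    using x0(1) that by (auto simp: good_def Z_def)
  have "((\<lambda>t. LINT x|lebesgue_on \<Omega>. w t x - indicator S x * Z t) \<longlongrightarrow>
      (LINT x|lebesgue_on \<Omega>. 0)) at_top"
  proof (rule integral_dominated_convergence_at_top)
    show "\<forall>\<^sub>F t in at_top. AE x in lebesgue_on \<Omega>. norm (w t x - indicator S x * Z t) \<le> 2 * M"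
    proof (rule eventually_mono[OF eventually_ge_at_top[of 0]])
      fix t :: real assume t: "0 \<le> t"
      show "AE x in lebesgue_on \<Omega>. norm (w t x - indicator S x * Z t) \<le> 2 * M"
        using good
      proof eventually_elim
        case (elim x)
        then have "\<bar>w t x\<bar> \<le> M" using t by (auto simp: good_def)
        moreover have "\<bar>indicator S x * Z t\<bar> \<le> M" using Z_bd[OF t] M_pos by (simp add: indicator_def)
        ultimately show ?case unfolding real_norm_def by linarith
      qed
    qed
    show "AE x in lebesgue_on \<Omega>. ((\<lambda>t. w t x - indicator S x * Z t) \<longlongrightarrow> 0) at_top"
      using good by eventually_elim (rule merge)
  qed simp_all
  then have "((\<lambda>t. ?m - ?A * Z t) \<longlongrightarrow> 0) at_top"
    by (simp only: Bochner_Integration.integral_zero)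
      (erule Lim_transform_eventually,
        rule eventually_mono[OF eventually_ge_at_top[of 0]], rule mass)
  from tendsto_diff[OF tendsto_const[of ?m] this] have AZ: "((\<lambda>t. ?A * Z t) \<longlongrightarrow> ?m) at_top" by simp
  have "?m \<noteq> 0"
  proof
    assume "?m = 0"
    then have "(LINT x|lebesgue_on \<Omega>. - u 0 x) = 0" by simp
    moreover have "AE x in lebesgue_on \<Omega>. 0 \<le> - u 0 x" using init_nonpos by eventually_elim simp
    ultimately have "AE x in lebesgue_on \<Omega>. - u 0 x = 0"
      using int_u[of 0] by (subst (asm) integral_nonneg_eq_0_iff_AE) auto
    then show False using nz by simp
  qed
  moreover have "?m \<le> 0"
  proof -
    have "?m \<le> (LINT x|lebesgue_on \<Omega>. 0)"
      by (rule integral_mono_AE) (use int_u[of 0] init_nonpos in auto)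
    then show ?thesis by simp
  qed
  ultimately have m: "?m < 0" by simp
  have A: "?A \<noteq> 0"
  proof
    assume "?A = 0"
    with AZ have "((\<lambda>t::real. 0) \<longlongrightarrow> ?m) at_top" by simp
    then have "0 = ?m" by (rule tendsto_unique[OF trivial_limit_at_top_linorder tendsto_const])
    with m show False by simp
  qed
  then have "?A > 0" by (simp add: zero_less_measure_iff)
  have Z: "(Z \<longlongrightarrow> ?m / ?A) at_top"
    using tendsto_divide[OF AZ tendsto_const[of ?A] A] A by simp
  have "AE x in lebesgue_on \<Omega>. ((\<lambda>t. w t x) \<longlongrightarrow> ?m / ?A * indicator S x) at_top"
    using good
  proof eventually_elim
    case (elim x)
    from tendsto_add[OF merge[OF elim] tendsto_mult[OF tendsto_const[of "indicator S x"] Z]]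
    show ?case by (simp add: mult.commute)
  qed
  moreover have "?m / ?A < 0" using m \<open>?A > 0\<close> by (simp add: divide_neg_pos)
  ultimately show ?thesis using A by (intro exI[of _ "?m / ?A"]) simp
qed

text \<open>Dominated convergence needs paths that converge as t runs through all reals, so it is
  applied to \<open>w\<close>; the integrals are then transferred to \<open>u\<close> at each time.
  The first claim is meant for f and g in \<open>lam\<close>, the second for the omega-limit
  set.\<close>

lemma integral_comp_tendsto:
  fixes \<phi> :: "'a \<Rightarrow> real" and \<psi> :: "real \<Rightarrow> real"
  assumes \<phi>: "\<phi> \<in> borel_measurable (lebesgue_on \<Omega>)"
    and lim: "AE x in lebesgue_on \<Omega>. ((\<lambda>t. w t x) \<longlongrightarrow> \<phi> x) at_top"
    and cont: "continuous_on UNIV \<psi>"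
  shows "((\<lambda>t. LINT x|lebesgue_on \<Omega>. \<psi> (u t x)) \<longlongrightarrow> (LINT x|lebesgue_on \<Omega>. \<psi> (\<phi> x))) at_top"
    and "((\<lambda>t. LINT x|lebesgue_on \<Omega>. \<bar>u t x - \<phi> x\<bar>) \<longlongrightarrow> 0) at_top"
proof -
  have [measurable]: "\<psi> \<in> borel_measurable borel" by (rule borel_measurable_continuous_onI[OF cont])
  note [measurable] = \<phi>
  have "compact (\<psi> ` {- M..0})"
    by (rule compact_continuous_image[OF continuous_on_subset[OF cont subset_UNIV] compact_Icc])
  then obtain P where P: "\<And>z. z \<in> {- M..0} \<Longrightarrow> \<bar>\<psi> z\<bar> \<le> P"
    by (force simp: bounded_iff dest!: compact_imp_bounded)
  have "((\<lambda>t. LINT x|lebesgue_on \<Omega>. \<psi> (w t x)) \<longlongrightarrow> (LINT x|lebesgue_on \<Omega>. \<psi> (\<phi> x))) at_top"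
  proof (rule integral_dominated_convergence_at_top[where w = "\<lambda>_. P"])
    show "\<forall>\<^sub>F t in at_top. AE x in lebesgue_on \<Omega>. norm (\<psi> (w t x)) \<le> P"
    proof (rule eventually_mono[OF eventually_ge_at_top[of 0]])
      fix t :: real assume "0 \<le> t"
      with AE_w_bounds show "AE x in lebesgue_on \<Omega>. norm (\<psi> (w t x)) \<le> P"
        by (auto elim!: eventually_mono intro!: P)
    qed
    show "AE x in lebesgue_on \<Omega>. ((\<lambda>t. \<psi> (w t x)) \<longlongrightarrow> \<psi> (\<phi> x)) at_top"
      using lim by eventually_elim (rule continuous_on_tendsto_compose[OF cont], auto)
  qed simp_all
  moreover have "(LINT x|lebesgue_on \<Omega>. \<psi> (w t x)) = (LINT x|lebesgue_on \<Omega>. \<psi> (u t x))" if t: "t \<ge> 0" for t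
  proof (rule integral_cong_AE)
    show "(\<lambda>x. \<psi> (u t x)) \<in> borel_measurable (lebesgue_on \<Omega>)"
      using t by measurable
    show "AE x in lebesgue_on \<Omega>. \<psi> (w t x) = \<psi> (u t x)" using AE_w_eq[OF t] by eventually_elim simp
  qed simp
  ultimately show "((\<lambda>t. LINT x|lebesgue_on \<Omega>. \<psi> (u t x)) \<longlongrightarrow> (LINT x|lebesgue_on \<Omega>. \<psi> (\<phi> x))) at_top"
    by (elim Lim_transform_eventually) (rule eventually_mono[OF eventually_ge_at_top[of 0]])
  have "((\<lambda>t. LINT x|lebesgue_on \<Omega>. \<bar>w t x - \<phi> x\<bar>) \<longlongrightarrow> (LINT x|lebesgue_on \<Omega>. 0)) at_top"
  proof (rule integral_dominated_convergence_at_top[where w = "\<lambda>_. M"])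
    show "\<forall>\<^sub>F t in at_top. AE x in lebesgue_on \<Omega>. norm \<bar>w t x - \<phi> x\<bar> \<le> M"
    proof (rule eventually_mono[OF eventually_ge_at_top[of 0]])
      fix t :: real assume t: "0 \<le> t"
      from AE_w_bounds lim show "AE x in lebesgue_on \<Omega>. norm \<bar>w t x - \<phi> x\<bar> \<le> M"
      proof eventually_elim
        case (elim x)
        \<comment> \<open>The limit inherits the range [-M,0] of the path, so two such values differ
          by at most M.\<close>
        have "- M \<le> \<phi> x"
          by (rule tendsto_lowerbound[OF elim(2) eventually_mono[OF eventually_ge_at_top[of 0]]])
            (use elim(1) in auto)
        moreover have "\<phi> x \<le> 0"
          by (rule tendsto_upperbound[OF elim(2) eventually_mono[OF eventually_ge_at_top[of 0]]])
            (use elim(1) in auto)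
        moreover have "- M \<le> w t x" "w t x \<le> 0" using elim(1) t by auto
        ultimately show ?case by simp
      qed
    qed
    show "AE x in lebesgue_on \<Omega>. ((\<lambda>t. \<bar>w t x - \<phi> x\<bar>) \<longlongrightarrow> 0) at_top"
      using lim
    proof eventually_elim
      case (elim x)
      from tendsto_rabs[OF tendsto_diff[OF elim tendsto_const[of "\<phi> x"]]] show ?case by simp
    qed
  qed simp_all
  then have "((\<lambda>t. LINT x|lebesgue_on \<Omega>. \<bar>w t x - \<phi> x\<bar>) \<longlongrightarrow> 0) at_top" by simp
  moreover have "(LINT x|lebesgue_on \<Omega>. \<bar>w t x - \<phi> x\<bar>) = (LINT x|lebesgue_on \<Omega>. \<bar>u t x - \<phi> x\<bar>)"
    if t: "t \<ge> 0" for t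
  proof (rule integral_cong_AE)
    show "(\<lambda>x. \<bar>u t x - \<phi> x\<bar>) \<in> borel_measurable (lebesgue_on \<Omega>)"
      using t by measurable
    show "AE x in lebesgue_on \<Omega>. \<bar>w t x - \<phi> x\<bar> = \<bar>u t x - \<phi> x\<bar>"
      using AE_w_eq[OF t] by eventually_elim simp
  qed simp
  ultimately show "((\<lambda>t. LINT x|lebesgue_on \<Omega>. \<bar>u t x - \<phi> x\<bar>) \<longlongrightarrow> 0) at_top"
    by (elim Lim_transform_eventually) (rule eventually_mono[OF eventually_ge_at_top[of 0]])
qed

end

section \<open>The limit of the coefficient and the omega-limit set\<close>

lemma (in finite_measure) integral_comp_indicator:
  fixes \<psi> :: "real \<Rightarrow> real"
  assumes "S \<in> sets M" "\<psi> 0 = 0"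
  shows "(LINT x|M. \<psi> (c * indicator S x)) = \<psi> c * measure M S"
proof -
  have "\<psi> (c * indicator S x) = indicator S x * \<psi> c" for x
    using assms(2) by (simp add: indicator_def)
  then show ?thesis using sets.sets_into_space[OF assms(1)] by (simp add: Int_absorb2)
qed

theorem theorem4p5:
  fixes \<Omega> :: "'a::euclidean_space set"
    and u\<^sub>0 :: "'a \<Rightarrow> real"
    and u :: "real \<Rightarrow> 'a \<Rightarrow> real"
  assumes "open \<Omega>" and "bounded \<Omega>"
    and "u\<^sub>0 \<in> Linf \<Omega>"
    and "AE x in lebesgue_on \<Omega>. u\<^sub>0 x \<le> 0"
    and "\<not> (AE x in lebesgue_on \<Omega>. u\<^sub>0 x = 0)"
    and "global_solution \<Omega> u\<^sub>0 u"
  shows "\<exists>lam_inf :: real.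
    (lam \<Omega> u \<longlongrightarrow> lam_inf) at_top \<and>
    lam_inf * measure lebesgue (Omega_minus \<Omega> u\<^sub>0) = (LINT x|lebesgue_on \<Omega>. u\<^sub>0 x) \<and>
    (\<lambda>x. lam_inf * indicator (Omega_minus \<Omega> u\<^sub>0) x) \<in> omega_limit_set \<Omega> u \<and>
    (\<forall>\<phi>\<in>omega_limit_set \<Omega> u.
       AE x in lebesgue_on \<Omega>. \<phi> x = lam_inf * indicator (Omega_minus \<Omega> u\<^sub>0) x)"
proof -
  from \<open>global_solution \<Omega> u\<^sub>0 u\<close> obtain v where v: "C1_Linf \<Omega> u v"
    "AE x in lebesgue_on \<Omega>. u 0 x = u\<^sub>0 x"
    "\<forall>t\<ge>0. (LINT x|lebesgue_on \<Omega>. g_react (u t x)) \<noteq> 0"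
    "\<forall>t\<ge>0. AE x in lebesgue_on \<Omega>. v t x = f_react (u t x) - lam \<Omega> u t * g_react (u t x)"
    unfolding global_solution_def by blast
  obtain M where M: "M > 0" "AE x in lebesgue_on \<Omega>. \<bar>u\<^sub>0 x\<bar> \<le> M"
    using Linf_imp_AE_bounded[OF \<open>u\<^sub>0 \<in> Linf \<Omega>\<close>] by blast
  have lmeas: "\<Omega> \<in> lmeasurable" using assms(1,2) by (simp add: lmeasurable_open)
  interpret nonpositive_solution \<Omega> u v M
  proof unfold_locales
    show "AE x in lebesgue_on \<Omega>. u 0 x \<le> 0" using v(2) assms(4) by eventually_elim simp
    show "AE x in lebesgue_on \<Omega>. - M \<le> u 0 x" using v(2) M(2) by eventually_elim simp
  qed (use lmeas v M in auto)
  let ?S = "Omega_minus \<Omega> u\<^sub>0"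
  have u0_meas: "u\<^sub>0 \<in> borel_measurable (lebesgue_on \<Omega>)" using assms(3) by (simp add: Linf_def)
  then have "{x \<in> space (lebesgue_on \<Omega>). u\<^sub>0 x < 0} \<in> sets (lebesgue_on \<Omega>)" by measurable
  then have S: "?S \<in> sets (lebesgue_on \<Omega>)" by (simp add: Omega_minus_def)
  have S_AE: "AE x in lebesgue_on \<Omega>. x \<in> ?S \<longleftrightarrow> u 0 x < 0"
    using v(2) AE_space by eventually_elim (simp add: Omega_minus_def)
  have nz: "\<not> (AE x in lebesgue_on \<Omega>. u 0 x = 0)"
  proof
    assume "AE x in lebesgue_on \<Omega>. u 0 x = 0"
    with v(2) have "AE x in lebesgue_on \<Omega>. u\<^sub>0 x = 0" by eventually_elim simp
    with assms(5) show False by simp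
  qed
  obtain \<Lambda> where \<Lambda>: "\<Lambda> < 0" "measure (lebesgue_on \<Omega>) ?S \<noteq> 0"
    "\<Lambda> * measure (lebesgue_on \<Omega>) ?S = (LINT x|lebesgue_on \<Omega>. u 0 x)"
    "AE x in lebesgue_on \<Omega>. ((\<lambda>t. w t x) \<longlongrightarrow> \<Lambda> * indicator ?S x) at_top"
    using w_converges[OF S S_AE nz] by blast
  define \<phi> where "\<phi> x = \<Lambda> * indicator ?S x" for x
  have \<phi>_meas: "\<phi> \<in> borel_measurable (lebesgue_on \<Omega>)"
    unfolding \<phi>_def using S by (intro borel_measurable_times borel_measurable_indicator) auto
  have \<phi>_int: "integrable (lebesgue_on \<Omega>) \<phi>"
    by (rule integrable_AE_bounded[OF \<phi>_meas, of "\<bar>\<Lambda>\<bar>"]) (simp add: \<phi>_def abs_mult indicator_def)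
  have lim: "AE x in lebesgue_on \<Omega>. ((\<lambda>t. w t x) \<longlongrightarrow> \<phi> x) at_top"
    unfolding \<phi>_def by (rule \<Lambda>(4))
  have L1: "((\<lambda>t. LINT x|lebesgue_on \<Omega>. \<bar>u t x - \<phi> x\<bar>) \<longlongrightarrow> 0) at_top"
    by (rule integral_comp_tendsto(2)[OF \<phi>_meas lim continuous_on_id])
  \<comment> \<open>Since f(z) = z g(z), the quotient of the two limit integrals is exactly
    \<Lambda>; the denominator is nonzero because \<Lambda> < 0 and S has positive measure.\<close>
  have g\<Lambda>: "g_react \<Lambda> \<noteq> 0" "f_react \<Lambda> = \<Lambda> * g_react \<Lambda>"
    using \<Lambda>(1) by (simp_all add: g_react_def f_react_def power2_eq_square)
  have "(lam \<Omega> u \<longlongrightarrow> \<Lambda>) at_top"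
  proof -
    have "(LINT x|lebesgue_on \<Omega>. f_react (\<phi> x)) = f_react \<Lambda> * measure (lebesgue_on \<Omega>) ?S"
      "(LINT x|lebesgue_on \<Omega>. g_react (\<phi> x)) = g_react \<Lambda> * measure (lebesgue_on \<Omega>) ?S"
      unfolding \<phi>_def by (intro integral_comp_indicator S; simp add: f_react_def g_react_def)+
    then have "((\<lambda>t. (LINT x|lebesgue_on \<Omega>. f_react (u t x)) / (LINT x|lebesgue_on \<Omega>. g_react (u t x)))
        \<longlongrightarrow> (f_react \<Lambda> * measure (lebesgue_on \<Omega>) ?S) / (g_react \<Lambda> * measure (lebesgue_on \<Omega>) ?S)) at_top"
      using integral_comp_tendsto(1)[OF \<phi>_meas lim continuous_react(1)]
        integral_comp_tendsto(1)[OF \<phi>_meas lim continuous_react(2)] g\<Lambda> \<Lambda>(2)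
      by (intro tendsto_divide) auto
    then show ?thesis using g\<Lambda> \<Lambda>(2) by (simp add: lam_def[abs_def])
  qed
  moreover have "\<Lambda> * measure lebesgue ?S = (LINT x|lebesgue_on \<Omega>. u\<^sub>0 x)"
  proof -
    have "measure (lebesgue_on \<Omega>) ?S = measure lebesgue ?S"
      using lmeas by (intro measure_restrict_space) (auto simp: Omega_minus_def fmeasurable_def)
    moreover have "(LINT x|lebesgue_on \<Omega>. u 0 x) = (LINT x|lebesgue_on \<Omega>. u\<^sub>0 x)"
      by (rule integral_cong_AE) (use u0_meas measurable_u[of 0] v(2) in auto)
    ultimately show ?thesis using \<Lambda>(3) by simp
  qed
  moreover have "\<phi> \<in> omega_limit_set \<Omega> u"
    unfolding omega_limit_set_def
  \<comment> \<open>Convergence holds along the full time axis, so the times t_n = n serve as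
    witness.\<close>
  proof (intro CollectI conjI \<phi>_int exI[of _ real] allI)
    show "(\<lambda>n. LINT x|lebesgue_on \<Omega>. \<bar>u (real n) x - \<phi> x\<bar>) \<longlonglongrightarrow> 0"
      by (rule filterlim_compose[OF L1 filterlim_real_sequentially])
  qed (auto simp: filterlim_real_sequentially)
  moreover have "AE x in lebesgue_on \<Omega>. \<phi>' x = \<phi> x" if "\<phi>' \<in> omega_limit_set \<Omega> u" for \<phi>'
  proof -
    from that obtain t :: "nat \<Rightarrow> real" where \<phi>': "integrable (lebesgue_on \<Omega>) \<phi>'"
      and t: "\<And>n. t n \<ge> 0" "filterlim t at_top sequentially"
      and conv: "(\<lambda>n. LINT x|lebesgue_on \<Omega>. \<bar>u (t n) x - \<phi>' x\<bar>) \<longlonglongrightarrow> 0"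
      by (auto simp: omega_limit_set_def)
    have "(\<lambda>n. LINT x|lebesgue_on \<Omega>. \<bar>u (t n) x - \<phi> x\<bar>) \<longlonglongrightarrow> 0"
      by (rule filterlim_compose[OF L1 t(2)])
    from tendsto_add[OF conv this]
    have sum: "(\<lambda>n. (LINT x|lebesgue_on \<Omega>. \<bar>u (t n) x - \<phi>' x\<bar>) + (LINT x|lebesgue_on \<Omega>. \<bar>u (t n) x - \<phi> x\<bar>))
        \<longlonglongrightarrow> 0" by simp
    \<comment> \<open>Triangle inequality through \<open>u (t n)\<close>: the left side does not
      depend on n, while the right side tends to 0.\<close>
    have "(LINT x|lebesgue_on \<Omega>. \<bar>\<phi>' x - \<phi> x\<bar>) \<le>
        (LINT x|lebesgue_on \<Omega>. \<bar>u (t n) x - \<phi>' x\<bar>) + (LINT x|lebesgue_on \<Omega>. \<bar>u (t n) x - \<phi> x\<bar>)" for n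
    proof -
      have int: "integrable (lebesgue_on \<Omega>) (u (t n))"
        using integrable_comp_u[of "\<lambda>z. z", OF _ t(1)] by simp
      have "(LINT x|lebesgue_on \<Omega>. \<bar>\<phi>' x - \<phi> x\<bar>)
          \<le> (LINT x|lebesgue_on \<Omega>. \<bar>u (t n) x - \<phi>' x\<bar> + \<bar>u (t n) x - \<phi> x\<bar>)"
        using int \<phi>' \<phi>_int by (intro integral_mono) auto
      also have "\<dots> = (LINT x|lebesgue_on \<Omega>. \<bar>u (t n) x - \<phi>' x\<bar>) + (LINT x|lebesgue_on \<Omega>. \<bar>u (t n) x - \<phi> x\<bar>)"
        using int \<phi>' \<phi>_int by (intro Bochner_Integration.integral_add) auto
      finally show ?thesis .
    qed
    then have "(LINT x|lebesgue_on \<Omega>. \<bar>\<phi>' x - \<phi> x\<bar>) \<le> 0"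
      using LIMSEQ_le_const[OF sum] by blast
    moreover have "(LINT x|lebesgue_on \<Omega>. \<bar>\<phi>' x - \<phi> x\<bar>) \<ge> 0"
      by (rule integral_nonneg_AE) simp
    ultimately have "(LINT x|lebesgue_on \<Omega>. \<bar>\<phi>' x - \<phi> x\<bar>) = 0" by simp
    then have "AE x in lebesgue_on \<Omega>. \<bar>\<phi>' x - \<phi> x\<bar> = 0"
      using \<phi>' \<phi>_int by (subst (asm) integral_nonneg_eq_0_iff_AE) auto
    then show ?thesis by eventually_elim simp
  qed
  ultimately show ?thesis
    unfolding \<phi>_def by (intro exI[of _ \<Lambda>] conjI ballI) auto
qed

end
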